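(* Let $\mathbf Y=(Y,\mathcal Y,\nu,T)$ be an ergodic system and let $G$ be a compact second countable topological group with normalized Haar measure $\lambda_G$ and Borel $\sigma$-algebra $\mathcal B_G$. Then for a generic $\phi\in\mathcal C(Y,G)$ the skew product system $\mathbf Y_\phi=(Y\times G,\mathcal Y\times\mathcal B_G,\nu\times\lambda_G,T_\phi)$, $T_\phi(y,g)=(Ty,\phi(y)g)$, is ergodic.
   Context: A system is a standard probability space with an invertible measure preserving transformation. $\mathcal C(Y,G)$ is the set of Borel maps $\phi:Y\to G$, identified when equal $\nu$-a.e., with the complete separable metric $d(\phi,\psi)=\inf\{\epsilon:\nu(\{y: d_G(\phi(y),\psi(y))>\epsilon\})<\epsilon\}$, where $d_G$ is a bi-invariant compatible metric on $G$. "For a generic $\phi$" means for all $\phi$ in a set containing a dense $G_\delta$ subset of $\mathcal C(Y,G)$.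
   Formalization: The standard probability space of Y is assumed non-atomic: with atoms the claim fails, e.g. for Y a single point and G = Z/2, where C(Y,G) is discrete and the trivial cocycle gives a non-ergodic skew product. *)

theory Defs
  imports "HOL-Probability.Probability"
begin

definition standard_borel :: "'a measure \<Rightarrow> bool" where
  "standard_borel M \<longleftrightarrow>
     (\<exists>X. completely_metrizable_space X \<and> second_countable X \<and>
          topspace X = space M \<and> sets M = sigma_sets (topspace X) {U. openin X U})"

definition standard_prob_space :: "'a measure \<Rightarrow> bool" where
  "standard_prob_space M \<longleftrightarrow> prob_space M \<and> standard_borel M"

text \<open>
  Generic ergodicity of skew products fails in the presence of atoms: over a one-point base
  with group \<open>\<int>/2\<close>, the trivial cocycle is isolated and its skew product is not ergodic.
\<close>

definition nonatomic :: "'a measure \<Rightarrow> bool" where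
  "nonatomic M \<longleftrightarrow>
     (\<forall>A\<in>sets M. 0 < emeasure M A \<longrightarrow>
        (\<exists>B\<in>sets M. B \<subseteq> A \<and> 0 < emeasure M B \<and> emeasure M B < emeasure M A))"

definition invertible_mpt :: "'a measure \<Rightarrow> ('a \<Rightarrow> 'a) \<Rightarrow> bool" where
  "invertible_mpt M T \<longleftrightarrow>
     T \<in> measurable M M \<and> bij_betw T (space M) (space M) \<and>
     the_inv_into (space M) T \<in> measurable M M \<and> distr M M T = M"

definition system :: "'a measure \<Rightarrow> ('a \<Rightarrow> 'a) \<Rightarrow> bool" where
  "system M T \<longleftrightarrow> standard_prob_space M \<and> invertible_mpt M T"

definition ergodic_system :: "'a measure \<Rightarrow> ('a \<Rightarrow> 'a) \<Rightarrow> bool" where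
  "ergodic_system M T \<longleftrightarrow>
     system M T \<and>
     (\<forall>A\<in>sets M. T -` A \<inter> space M = A \<longrightarrow> measure M A = 0 \<or> measure M A = 1)"

text \<open>
  Groups are written additively, following the library class of topological groups,
  but are not assumed to be commutative.
\<close>

definition normalized_haar :: "'g::topological_group_add measure \<Rightarrow> bool" where
  "normalized_haar L \<longleftrightarrow>
     sets L = sets borel \<and> prob_space L \<and>
     (\<forall>g. \<forall>A\<in>sets borel. emeasure L ((+) g ` A) = emeasure L A)"

definition biinvariant_compatible_metric ::
    "('g::topological_group_add \<Rightarrow> 'g \<Rightarrow> real) \<Rightarrow> bool" where
  "biinvariant_compatible_metric d \<longleftrightarrow>
     Metric_space UNIV d \<and> Metric_space.mtopology UNIV d = euclidean \<and>
     (\<forall>a x y. d (a + x) (a + y) = d x y) \<and> (\<forall>a x y. d (x + a) (y + a) = d x y)"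

definition skew_product ::
    "('a \<Rightarrow> 'a) \<Rightarrow> ('a \<Rightarrow> 'g::topological_group_add) \<Rightarrow> 'a \<times> 'g \<Rightarrow> 'a \<times> 'g" where
  "skew_product T \<phi> = (\<lambda>(y, g). (T y, \<phi> y + g))"

definition ae_eq_rel :: "'a measure \<Rightarrow> (('a \<Rightarrow> 'g::topological_space) \<times> ('a \<Rightarrow> 'g)) set" where
  "ae_eq_rel M = {(\<phi>, \<psi>). \<phi> \<in> borel_measurable M \<and> \<psi> \<in> borel_measurable M \<and>
                           (AE y in M. \<phi> y = \<psi> y)}"

definition cocycles :: "'a measure \<Rightarrow> ('a \<Rightarrow> 'g::topological_space) set set" where
  "cocycles M = borel_measurable M // ae_eq_rel M"

definition map_dist ::
    "'a measure \<Rightarrow> ('g \<Rightarrow> 'g \<Rightarrow> real) \<Rightarrow> ('a \<Rightarrow> 'g) \<Rightarrow> ('a \<Rightarrow> 'g) \<Rightarrow> real" where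
  "map_dist M d \<phi> \<psi> = Inf {e. measure M {y \<in> space M. d (\<phi> y) (\<psi> y) > e} < e}"

text \<open>The choice of representatives is irrelevant, see \<open>cocycle_dist_eq\<close> below.\<close>

definition cocycle_dist ::
    "'a measure \<Rightarrow> ('g \<Rightarrow> 'g \<Rightarrow> real) \<Rightarrow> ('a \<Rightarrow> 'g) set \<Rightarrow> ('a \<Rightarrow> 'g) set \<Rightarrow> real" where
  "cocycle_dist M d c c' = map_dist M d (SOME \<phi>. \<phi> \<in> c) (SOME \<psi>. \<psi> \<in> c')"

definition cocycle_topology ::
    "'a measure \<Rightarrow> ('g::topological_space \<Rightarrow> 'g \<Rightarrow> real) \<Rightarrow> ('a \<Rightarrow> 'g) set topology" where
  "cocycle_topology M d = Metric_space.mtopology (cocycles M) (cocycle_dist M d)"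

definition generic_in :: "'b topology \<Rightarrow> 'b set \<Rightarrow> bool" where
  "generic_in X S \<longleftrightarrow>
     (\<exists>D. D \<subseteq> S \<and> gdelta_in X D \<and> X closure_of D = topspace X)"

lemma equiv_ae_eq_rel:
  fixes M :: "'a measure"
  shows "equiv (borel_measurable M :: ('a \<Rightarrow> 'b::topological_space) set) (ae_eq_rel M)"
proof (rule equivI)
  show "(ae_eq_rel M :: (('a \<Rightarrow> 'b) \<times> _) set) \<subseteq> borel_measurable M \<times> borel_measurable M"
    by (auto simp: ae_eq_rel_def)
  show "refl_on (borel_measurable M :: ('a \<Rightarrow> 'b) set) (ae_eq_rel M)"
    by (auto simp: refl_on_def ae_eq_rel_def)
  show "sym (ae_eq_rel M :: (('a \<Rightarrow> 'b) \<times> _) set)"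
  proof (rule symI)
    fix \<phi> \<psi> :: "'a \<Rightarrow> 'b"
    assume 1: "(\<phi>, \<psi>) \<in> ae_eq_rel M"
    then have "AE y in M. \<phi> y = \<psi> y"
      by (simp add: ae_eq_rel_def)
    then have "AE y in M. \<psi> y = \<phi> y"
      by eventually_elim simp
    with 1 show "(\<psi>, \<phi>) \<in> ae_eq_rel M"
      by (simp add: ae_eq_rel_def)
  qed
  show "trans (ae_eq_rel M :: (('a \<Rightarrow> 'b) \<times> _) set)"
  proof (rule transI)
    fix \<phi> \<psi> \<eta> :: "'a \<Rightarrow> 'b"
    assume 1: "(\<phi>, \<psi>) \<in> ae_eq_rel M" and 2: "(\<psi>, \<eta>) \<in> ae_eq_rel M"
    then have "AE y in M. \<phi> y = \<psi> y" "AE y in M. \<psi> y = \<eta> y"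
      by (simp_all add: ae_eq_rel_def)
    then have "AE y in M. \<phi> y = \<eta> y"
      by eventually_elim simp
    with 1 2 show "(\<phi>, \<eta>) \<in> ae_eq_rel M"
      by (simp add: ae_eq_rel_def)
  qed
qed

lemma metric_measurable:
  fixes d :: "'g::second_countable_topology \<Rightarrow> 'g \<Rightarrow> real"
  assumes "Metric_space UNIV d" and top: "Metric_space.mtopology UNIV d = euclidean"
    and f: "f \<in> borel_measurable M" and g: "g \<in> borel_measurable M"
  shows "(\<lambda>y. d (f y) (g y)) \<in> borel_measurable M"
proof -
  interpret D: Metric_space UNIV d by (rule assms(1))
  have op: "open (D.mball a r)" for a r
    using D.openin_mball[of a r] by (simp add: top)
  have "continuous_on UNIV (\<lambda>x. d (fst x) (snd x))"
    unfolding continuous_on_def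
  proof (intro ballI tendstoI)
    fix p :: "'g \<times> 'g" and e :: real
    assume "0 < e"
    obtain a b where p: "p = (a, b)" by (cases p)
    let ?U = "D.mball a (e/2) \<times> D.mball b (e/2)"
    have "open ?U" "p \<in> ?U"
      using \<open>0 < e\<close> by (auto simp: p intro!: open_Times op)
    moreover have "dist (d (fst q) (snd q)) (d (fst p) (snd p)) < e" if "q \<in> ?U" for q
    proof -
      obtain x y where q: "q = (x, y)" by (cases q)
      have *: "d a x < e/2" "d b y < e/2" using that by (auto simp: q)
      have "d x y \<le> d x a + d a b + d b y" "d a b \<le> d a x + d x y + d y b"
        using D.triangle[of x a y] D.triangle[of a b y] D.triangle[of a x b] D.triangle[of x y b]
        by auto
      then show ?thesis
        using * D.commute[of x a] D.commute[of y b] by (simp add: p q dist_real_def)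
    qed
    ultimately show "\<forall>\<^sub>F q in at p. dist (d (fst q) (snd q)) (d (fst p) (snd p)) < e"
      unfolding eventually_at_topological by blast
  qed
  then show ?thesis
    by (rule borel_measurable_continuous_Pair[OF f g])
qed

context
  fixes M :: "'a measure" and d :: "'g::second_countable_topology \<Rightarrow> 'g \<Rightarrow> real"
  assumes M: "prob_space M" and d: "Metric_space UNIV d"
    and top: "Metric_space.mtopology UNIV d = euclidean"
begin

interpretation prob_space M by (rule M)
interpretation D: Metric_space UNIV d by (rule d)

lemma far_sets:
  assumes "\<phi> \<in> borel_measurable M" "\<psi> \<in> borel_measurable M"
  shows "{y \<in> space M. d (\<phi> y) (\<psi> y) > e} \<in> sets M"
  using metric_measurable[OF d top assms] by (simp add: borel_measurable_iff_greater)

lemma map_dist_bdd: "bdd_below {e. measure M {y \<in> space M. d (\<phi> y) (\<psi> y) > e} < e}"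
proof (rule bdd_belowI)
  fix e assume "e \<in> {e. measure M {y \<in> space M. d (\<phi> y) (\<psi> y) > e} < e}"
  then show "0 \<le> e"
    using measure_nonneg[of M "{y \<in> space M. d (\<phi> y) (\<psi> y) > e}"]
    by (auto simp del: measure_nonneg)
qed

lemma map_dist_ne: "{e. measure M {y \<in> space M. d (\<phi> y) (\<psi> y) > e} < e} \<noteq> {}"
proof -
  have "measure M {y \<in> space M. d (\<phi> y) (\<psi> y) > 2} < 2"
    using prob_le_1[of "{y \<in> space M. d (\<phi> y) (\<psi> y) > 2}"] by linarith
  then show ?thesis by blast
qed

lemma map_dist_nonneg: "0 \<le> map_dist M d \<phi> \<psi>"
  unfolding map_dist_def
proof (rule cInf_greatest[OF map_dist_ne])
  fix e assume "e \<in> {e. measure M {y \<in> space M. d (\<phi> y) (\<psi> y) > e} < e}"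
  then show "0 \<le> e"
    using measure_nonneg[of M "{y \<in> space M. d (\<phi> y) (\<psi> y) > e}"]
    by (auto simp del: measure_nonneg)
qed

lemma map_dist_commute: "map_dist M d \<phi> \<psi> = map_dist M d \<psi> \<phi>"
  by (simp add: map_dist_def D.commute)

lemma map_dist_cong:
  assumes "(\<phi>, \<phi>') \<in> ae_eq_rel M" "(\<psi>, \<psi>') \<in> ae_eq_rel M"
  shows "map_dist M d \<phi> \<psi> = map_dist M d \<phi>' \<psi>'"
proof -
  have "measure M {y \<in> space M. d (\<phi> y) (\<psi> y) > e} = measure M {y \<in> space M. d (\<phi>' y) (\<psi>' y) > e}" for e
  proof (rule measure_eq_AE)
    show "AE y in M. (y \<in> {y \<in> space M. d (\<phi> y) (\<psi> y) > e}) = (y \<in> {y \<in> space M. d (\<phi>' y) (\<psi>' y) > e})"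
      using assms by (auto simp: ae_eq_rel_def)
  qed (use assms in \<open>auto intro!: far_sets simp: ae_eq_rel_def\<close>)
  then show ?thesis by (simp add: map_dist_def)
qed

lemma map_dist_zero_iff:
  assumes "\<phi> \<in> borel_measurable M" "\<psi> \<in> borel_measurable M"
  shows "map_dist M d \<phi> \<psi> = 0 \<longleftrightarrow> (AE y in M. \<phi> y = \<psi> y)"
proof
  let ?F = "\<lambda>e. {y \<in> space M. d (\<phi> y) (\<psi> y) > e}"
  assume 0: "map_dist M d \<phi> \<psi> = 0"
  have null: "measure M (?F r) = 0" if "r > 0" for r
  proof (rule ccontr)
    assume "measure M (?F r) \<noteq> 0"
    then have "0 < min r (measure M (?F r))"
      using that by (simp add: zero_less_measure_iff)
    then obtain e where e: "measure M (?F e) < e" "e < min r (measure M (?F r))"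
      using cInf_lessD[OF map_dist_ne[of \<phi> \<psi>], of "min r (measure M (?F r))"] 0
      unfolding map_dist_def by auto
    have "measure M (?F r) \<le> measure M (?F e)"
      using e by (intro finite_measure_mono far_sets assms) auto
    with e show False by simp
  qed
  have "AE y in M. d (\<phi> y) (\<psi> y) \<le> inverse (real (Suc n))" for n
  proof (rule AE_I')
    show "?F (inverse (real (Suc n))) \<in> null_sets M"
      using null[of "inverse (real (Suc n))"] far_sets[OF assms]
      by (simp add: null_sets_def emeasure_eq_measure)
  qed auto
  then have "AE y in M. \<forall>n. d (\<phi> y) (\<psi> y) \<le> inverse (real (Suc n))"
    by (simp add: AE_all_countable)
  then show "AE y in M. \<phi> y = \<psi> y"
  proof (rule AE_mp, intro AE_I2 impI)
    fix y assume *: "\<forall>n. d (\<phi> y) (\<psi> y) \<le> inverse (real (Suc n))"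
    have "\<not> 0 < d (\<phi> y) (\<psi> y)"
      using * reals_Archimedean[of "d (\<phi> y) (\<psi> y)"] by (auto simp: not_less[symmetric])
    then show "\<phi> y = \<psi> y"
      using D.nonneg[of "\<phi> y" "\<psi> y"] D.zero[of "\<phi> y" "\<psi> y"] by auto
  qed
next
  assume "AE y in M. \<phi> y = \<psi> y"
  then have "AE y in M. \<psi> y = \<phi> y"
    by eventually_elim simp
  then have eq: "map_dist M d \<phi> \<psi> = map_dist M d \<phi> \<phi>"
    using assms by (intro map_dist_cong) (simp_all add: ae_eq_rel_def)
  have "map_dist M d \<phi> \<phi> \<le> 0"
  proof (rule field_le_epsilon)
    fix e :: real assume "e > 0"
    then have "{y \<in> space M. d (\<phi> y) (\<phi> y) > e} = {}"
      by simp
    then have "e \<in> {e. measure M {y \<in> space M. d (\<phi> y) (\<phi> y) > e} < e}"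
      using \<open>e > 0\<close> by simp
    then show "map_dist M d \<phi> \<phi> \<le> 0 + e"
      unfolding map_dist_def add_0 by (rule cInf_lower[OF _ map_dist_bdd])
  qed
  then show "map_dist M d \<phi> \<psi> = 0"
    using map_dist_nonneg[of \<phi> \<psi>] eq by simp
qed

lemma map_dist_triangle:
  assumes \<phi>: "\<phi> \<in> borel_measurable M" and \<psi>: "\<psi> \<in> borel_measurable M"
    and \<eta>: "\<eta> \<in> borel_measurable M"
  shows "map_dist M d \<phi> \<eta> \<le> map_dist M d \<phi> \<psi> + map_dist M d \<psi> \<eta>"
proof -
  have *: "map_dist M d \<phi> \<eta> \<le> a + b"
    if a: "measure M {y \<in> space M. d (\<phi> y) (\<psi> y) > a} < a"
      and b: "measure M {y \<in> space M. d (\<psi> y) (\<eta> y) > b} < b" for a b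
  proof -
    have "measure M {y \<in> space M. d (\<phi> y) (\<eta> y) > a + b} \<le>
        measure M ({y \<in> space M. d (\<phi> y) (\<psi> y) > a} \<union> {y \<in> space M. d (\<psi> y) (\<eta> y) > b})"
    proof (rule finite_measure_mono)
      show "{y \<in> space M. d (\<phi> y) (\<eta> y) > a + b} \<subseteq>
          {y \<in> space M. d (\<phi> y) (\<psi> y) > a} \<union> {y \<in> space M. d (\<psi> y) (\<eta> y) > b}"
      proof
        fix y assume "y \<in> {y \<in> space M. d (\<phi> y) (\<eta> y) > a + b}"
        then show "y \<in> {y \<in> space M. d (\<phi> y) (\<psi> y) > a} \<union> {y \<in> space M. d (\<psi> y) (\<eta> y) > b}"
          using D.triangle[of "\<phi> y" "\<psi> y" "\<eta> y"] by auto
      qed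
    qed (intro sets.Un far_sets \<phi> \<psi> \<eta>)
    also have "\<dots> \<le> measure M {y \<in> space M. d (\<phi> y) (\<psi> y) > a} +
        measure M {y \<in> space M. d (\<psi> y) (\<eta> y) > b}"
      by (intro measure_Un_le far_sets \<phi> \<psi> \<eta>)
    also have "\<dots> < a + b"
      using a b by simp
    finally show ?thesis
      unfolding map_dist_def by (intro cInf_lower map_dist_bdd) simp
  qed
  have "map_dist M d \<phi> \<eta> - b \<le> map_dist M d \<phi> \<psi>"
    if "measure M {y \<in> space M. d (\<psi> y) (\<eta> y) > b} < b" for b
    unfolding map_dist_def[of M d \<phi> \<psi>]
    by (intro cInf_greatest map_dist_ne) (use *[OF _ that] in \<open>auto simp: algebra_simps\<close>)
  then have "map_dist M d \<phi> \<eta> - map_dist M d \<phi> \<psi> \<le> map_dist M d \<psi> \<eta>"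
    unfolding map_dist_def[of M d \<psi> \<eta>]
    by (intro cInf_greatest map_dist_ne) (auto simp: algebra_simps)
  then show ?thesis by simp
qed

lemma some_cocycle:
  assumes "c \<in> cocycles M"
  shows "(SOME \<phi>. \<phi> \<in> c) \<in> c" "(SOME \<phi>. \<phi> \<in> c) \<in> borel_measurable M"
proof -
  show *: "(SOME \<phi>. \<phi> \<in> c) \<in> c"
    using in_quotient_imp_non_empty[OF equiv_ae_eq_rel] assms
    unfolding cocycles_def by (metis some_in_eq)
  show "(SOME \<phi>. \<phi> \<in> c) \<in> borel_measurable M"
    using * in_quotient_imp_subset[OF equiv_ae_eq_rel] assms
    unfolding cocycles_def by blast
qed

lemma cocycle_dist_eq:
  assumes "c \<in> cocycles M" "c' \<in> cocycles M" "\<phi> \<in> c" "\<psi> \<in> c'"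
  shows "cocycle_dist M d c c' = map_dist M d \<phi> \<psi>"
proof -
  have "((SOME \<phi>. \<phi> \<in> c), \<phi>) \<in> ae_eq_rel M" "((SOME \<psi>. \<psi> \<in> c'), \<psi>) \<in> ae_eq_rel M"
    using assms some_cocycle(1)[OF assms(1)] some_cocycle(1)[OF assms(2)]
    unfolding cocycles_def
    by (blast intro: in_quotient_imp_in_rel[OF equiv_ae_eq_rel])+
  then show ?thesis
    unfolding cocycle_dist_def by (rule map_dist_cong)
qed

lemma Metric_space_cocycles: "Metric_space (cocycles M) (cocycle_dist M d)"
proof
  show "0 \<le> cocycle_dist M d x y" for x y
    by (simp add: cocycle_dist_def map_dist_nonneg)
  show "cocycle_dist M d x y = cocycle_dist M d y x" for x y
    by (simp add: cocycle_dist_def map_dist_commute)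
  fix x y :: "('a \<Rightarrow> 'g) set"
  assume x: "x \<in> cocycles M" and y: "y \<in> cocycles M"
  have "cocycle_dist M d x y = 0 \<longleftrightarrow> ((SOME \<phi>. \<phi> \<in> x), (SOME \<phi>. \<phi> \<in> y)) \<in> ae_eq_rel M"
    using some_cocycle(2)[OF x] some_cocycle(2)[OF y]
    by (simp add: cocycle_dist_def map_dist_zero_iff ae_eq_rel_def)
  also have "\<dots> \<longleftrightarrow> x = y"
    using quotient_eq_iff[OF equiv_ae_eq_rel] x y some_cocycle(1)[OF x] some_cocycle(1)[OF y]
    unfolding cocycles_def by metis
  finally show "cocycle_dist M d x y = 0 \<longleftrightarrow> x = y" .
  fix z :: "('a \<Rightarrow> 'g) set"
  assume z: "z \<in> cocycles M"
  show "cocycle_dist M d x z \<le> cocycle_dist M d x y + cocycle_dist M d y z"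
    unfolding cocycle_dist_def by (intro map_dist_triangle some_cocycle x y z)
qed

end

end

theory Submission
  imports Defs
begin

text \<open>
  A cocycle \<open>\<phi>\<close> has an ergodic skew product as soon as, for every \<open>f\<close> in a countable determining
  family of functions \<open>1\<^sub>A(y) \<rho>(g)\<close> with \<open>\<rho>\<close> Lipschitz, some ergodic average of \<open>f\<close> is arbitrarily close
  to \<open>\<integral>f\<close> in mean. For fixed \<open>f\<close>, bi-invariance makes the error of the \<open>n\<close>-th average Lipschitz in
  \<open>\<phi>\<close>, so this condition defines a countable intersection of open sets, and by Baire's theorem it
  suffices that each of them is dense.

  Every coboundary \<open>w(T y) - w(y)\<close> is conjugate to the trivial cocycle, so by Birkhoff's theorem its
  averages of \<open>f\<close> are asymptotically \<open>\<integral>f(z, w(z) + g) d\<nu>(z)\<close>. Given \<open>\<phi>\<close>, cut the orbits into blocks of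
  length \<open>H\<close>, using the time until the next visit to a set of tiny measure. Solving the coboundary
  equation for \<open>\<phi>\<close> inside each block gives a \<open>w\<close> with \<open>w(T y) - w(y) = \<phi>(y)\<close> off a set of measure
  about \<open>1/H\<close>, with one free group element per block. These elements are distributed over \<open>H\<close> classes
  of blocks of measure about \<open>1/H\<close> each; if they were independent and Haar distributed, the variance
  of \<open>\<integral>f(z, w(z) + g) d\<nu>(z)\<close> would be of order \<open>1/H\<close>, so a suitable choice makes it close to \<open>\<integral>f\<close>.
\<close>

section \<open>Birkhoff's theorem for bounded functions\<close>

text \<open>Halving: of \<open>B\<close> and \<open>A - B\<close> one has at most half the measure
  of \<open>A\<close>, and both have positive measure because \<open>B\<close> is strictly smaller
  than \<open>A\<close>. Iteration brings the measure below any \<open>(1/2) ^ n\<close>.\<close>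

lemma (in prob_space) exists_small_set:
  assumes na: "nonatomic M" and "0 < e"
  shows "\<exists>A\<in>sets M. 0 < prob A \<and> prob A < e"
proof -
  have "\<exists>A\<in>sets M. 0 < prob A \<and> prob A \<le> (1/2) ^ n" for n
  proof (induction n)
    case 0
    show ?case by (intro bexI[of _ "space M"]) (auto simp: prob_space)
  next
    case (Suc n)
    then obtain A where A: "A \<in> sets M" "0 < prob A" "prob A \<le> (1/2) ^ n" by blast
    then obtain B where B: "B \<in> sets M" "B \<subseteq> A" "0 < prob B" "prob B < prob A"
      using na by (auto simp: nonatomic_def emeasure_eq_measure ennreal_less_iff)
    have d: "prob (A - B) = prob A - prob B"
      using A B by (intro finite_measure_Diff) auto
    show ?case
    proof (cases "prob B \<le> prob A / 2")
      case True
      then show ?thesis using A B by (intro bexI[of _ B]) auto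
    next
      case False
      then show ?thesis using A B d by (intro bexI[of _ "A - B"]) auto
    qed
  qed
  moreover obtain n where "(1/2) ^ n < e"
    using real_arch_pow_inv[OF \<open>0 < e\<close>, of "1/2"] by auto
  ultimately show ?thesis
    by (meson le_less_trans)
qed

section \<open>Measure preserving maps and the maximal ergodic theorem\<close>

locale mpt = prob_space M for M :: "'a measure" +
  fixes T :: "'a \<Rightarrow> 'a"
  assumes T_measurable [measurable]: "T \<in> measurable M M"
    and distr_T: "distr M M T = M"
begin

lemma funpow_measurable [measurable]: "(T ^^ k) \<in> measurable M M"
  by (induction k) auto

lemma integral_T:
  fixes f :: "'a \<Rightarrow> real"
  assumes [measurable]: "f \<in> borel_measurable M"
  shows "(\<integral>y. f (T y) \<partial>M) = (\<integral>y. f y \<partial>M)"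
  using integral_distr[of T M M f] by (simp add: distr_T)

lemma measure_vimage_T:
  assumes "A \<in> sets M"
  shows "measure M (T -` A \<inter> space M) = measure M A"
  using measure_distr[OF T_measurable assms] by (simp add: distr_T)

lemma integral_funpow:
  fixes f :: "'a \<Rightarrow> real"
  assumes [measurable]: "f \<in> borel_measurable M"
  shows "(\<integral>y. f ((T ^^ k) y) \<partial>M) = (\<integral>y. f y \<partial>M)"
proof (induction k)
  case (Suc k)
  have "(\<integral>y. f ((T ^^ Suc k) y) \<partial>M) = (\<integral>y. f ((T ^^ k) (T y)) \<partial>M)"
    by (simp add: funpow_swap1)
  also have "\<dots> = (\<integral>y. f ((T ^^ k) y) \<partial>M)"
    by (rule integral_T) measurable
  finally show ?case using Suc by simp
qed simp

definition birkhoff_sum :: "('a \<Rightarrow> real) \<Rightarrow> nat \<Rightarrow> 'a \<Rightarrow> real" where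
  "birkhoff_sum f n y = (\<Sum>k<n. f ((T ^^ k) y))"

lemma birkhoff_sum_Suc: "birkhoff_sum f (Suc n) y = f y + birkhoff_sum f n (T y)"
  by (simp add: birkhoff_sum_def sum.lessThan_Suc_shift funpow_swap1 del: sum.lessThan_Suc)

lemma birkhoff_sum_measurable [measurable]:
  "f \<in> borel_measurable M \<Longrightarrow> birkhoff_sum f n \<in> borel_measurable M"
  unfolding birkhoff_sum_def[abs_def]
  by (intro borel_measurable_sum measurable_compose[OF funpow_measurable])

text \<open>The running maximum of the sums of length at most \<open>n\<close>.\<close>

primrec max_sum :: "('a \<Rightarrow> real) \<Rightarrow> nat \<Rightarrow> 'a \<Rightarrow> real" where
  "max_sum f 0 y = 0"
| "max_sum f (Suc n) y = max 0 (f y + max_sum f n (T y))"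

lemma max_sum_nonneg: "0 \<le> max_sum f n y"
  by (cases n) auto

lemma max_sum_mono: "max_sum f n y \<le> max_sum f (Suc n) y"
proof (induction n arbitrary: y)
  case (Suc n)
  show ?case
    using Suc[of "T y"] by (simp only: max_sum.simps(2))
qed simp

lemma birkhoff_sum_le_max_sum: "birkhoff_sum f n y \<le> max_sum f n y"
proof (induction n arbitrary: y)
  case (Suc n)
  show ?case
    using Suc[of "T y"] by (simp add: birkhoff_sum_Suc)
qed (simp add: birkhoff_sum_def)

lemma max_sum_measurable [measurable]:
  "f \<in> borel_measurable M \<Longrightarrow> max_sum f n \<in> borel_measurable M"
proof (induction n)
  case (Suc n)
  note [measurable] = Suc.prems Suc.IH[OF Suc.prems]
  show ?case
    unfolding max_sum.simps[abs_def] by measurable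
qed (simp add: max_sum.simps[abs_def])

lemma max_sum_le:
  assumes "\<And>y. \<bar>f y\<bar> \<le> K"
  shows "max_sum f n y \<le> n * K"
proof (induction n arbitrary: y)
  case (Suc n)
  have "0 \<le> K" using assms[of y] by linarith
  then show ?case
    using Suc[of "T y"] assms[of y] by (auto simp: algebra_simps intro: add_nonneg_nonneg)
qed simp

text \<open>Garsia's argument for the maximal ergodic theorem: where the running maximum is positive,
  \<open>f\<close> dominates the coboundary of the running maximum.\<close>

lemma maximal_ergodic:
  assumes [measurable]: "f \<in> borel_measurable M" and K: "\<And>y. \<bar>f y\<bar> \<le> K"
  shows "0 \<le> (\<integral>y. f y * indicator {y. 0 < max_sum f n y} y \<partial>M)"
proof (cases n)
  case (Suc m)
  have int: "integrable M (max_sum f n)" "integrable M (\<lambda>y. max_sum f n (T y))"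
    using max_sum_le[of f K, OF K] max_sum_nonneg
    by (auto intro!: integrable_const_bound[where B = "n * K"])
  have "0 = (\<integral>y. max_sum f n y - max_sum f n (T y) \<partial>M)"
    using int by (simp add: integral_T)
  also have "\<dots> \<le> (\<integral>y. f y * indicator {y. 0 < max_sum f n y} y \<partial>M)"
  proof (rule integral_mono)
    show "integrable M (\<lambda>y. f y * indicator {y. 0 < max_sum f n y} y)"
      using K by (intro integrable_const_bound[where B = K])
        (auto simp: abs_mult indicator_def intro: order.trans[OF abs_ge_zero])
    fix y
    show "max_sum f n y - max_sum f n (T y) \<le> f y * indicator {y. 0 < max_sum f n y} y"
    proof (cases "0 < max_sum f n y")
      case True
      then have "max_sum f n y = f y + max_sum f m (T y)"
        by (simp add: Suc max_def split: if_splits)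
      then show ?thesis
        using True max_sum_mono[of f m "T y"] by (simp add: Suc)
    next
      case False
      then show ?thesis
        using max_sum_nonneg[of f n "T y"] by simp
    qed
  qed (use int in auto)
  finally show ?thesis .
qed simp

text \<open>The sets where the running maximum is positive increase with \<open>n\<close> and
  exhaust almost every point, so the maximal inequality passes to the limit by dominated
  convergence.\<close>

lemma integral_nonneg_if_sums_positive:
  assumes [measurable]: "f \<in> borel_measurable M" and K: "\<And>y. \<bar>f y\<bar> \<le> K"
    and pos: "AE y in M. \<exists>n. 0 < birkhoff_sum f n y"
  shows "0 \<le> (\<integral>y. f y \<partial>M)"
proof (rule LIMSEQ_le_const)
  show "(\<lambda>n. \<integral>y. f y * indicator {y. 0 < max_sum f n y} y \<partial>M) \<longlonglongrightarrow> (\<integral>y. f y \<partial>M)"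
  proof (rule integral_dominated_convergence[where w = "\<lambda>_. K"])
    show "AE y in M. (\<lambda>n. f y * indicator {y. 0 < max_sum f n y} y) \<longlonglongrightarrow> f y"
      using pos
    proof eventually_elim
      fix y assume "\<exists>n. 0 < birkhoff_sum f n y"
      then obtain n where n: "0 < max_sum f n y"
        using birkhoff_sum_le_max_sum less_le_trans by metis
      have "0 < max_sum f m y" if "m \<ge> n" for m
        using n lift_Suc_mono_le[of "\<lambda>m. max_sum f m y", OF max_sum_mono that] by linarith
      then show "(\<lambda>n. f y * indicator {y. 0 < max_sum f n y} y) \<longlonglongrightarrow> f y"
        by (intro tendsto_eventually) (force simp: eventually_sequentially)
    qed
    show "AE y in M. norm (f y * indicator {y. 0 < max_sum f n y} y) \<le> K" for n
      using K by (auto simp: abs_mult indicator_def intro: order.trans[OF abs_ge_zero])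
  qed auto
  show "\<exists>N. \<forall>n\<ge>N. 0 \<le> (\<integral>y. f y * indicator {y. 0 < max_sum f n y} y \<partial>M)"
    using maximal_ergodic[of f K] K by auto
qed

end

section \<open>The pointwise ergodic theorem for an ergodic map\<close>

locale ergodic_mpt = mpt +
  assumes ergodic: "A \<in> sets M \<Longrightarrow> T -` A \<inter> space M = A \<Longrightarrow> prob A = 0 \<or> prob A = 1"
begin

text \<open>Unboundedness of the sums is an invariant property, since the sums at \<open>y\<close>
  and at \<open>T y\<close> differ by the single term \<open>f y\<close>. By ergodicity it has
  probability 0 or 1, and probability 1 would force a nonnegative integral.\<close>

lemma sums_bounded_above:
  assumes f[measurable]: "f \<in> borel_measurable M" and K: "\<And>y. \<bar>f y\<bar> \<le> K"
    and neg: "(\<integral>y. f y \<partial>M) < 0"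
  shows "AE y in M. \<exists>b::nat. \<forall>n. birkhoff_sum f n y \<le> b"
proof -
  \<comment> \<open>Natural numbers as bounds keep \<open>E\<close> a countable combination of
    measurable sets.\<close>
  define E where "E = {y \<in> space M. \<forall>b::nat. \<exists>n. birkhoff_sum f n y > b}"
  have E[measurable]: "E \<in> sets M"
    unfolding E_def by measurable
  have shift: "(\<forall>b::nat. \<exists>n. birkhoff_sum f n (T y) > b) \<longleftrightarrow> (\<forall>b::nat. \<exists>n. birkhoff_sum f n y > b)" for y
  proof safe
    fix b :: nat
    assume *: "\<forall>b::nat. \<exists>n. birkhoff_sum f n (T y) > b"
    obtain c :: nat where "b - f y \<le> c" using real_arch_simple by blast
    moreover obtain n where "birkhoff_sum f n (T y) > c" using * by blast
    ultimately show "\<exists>n. birkhoff_sum f n y > b"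
      by (intro exI[of _ "Suc n"]) (simp add: birkhoff_sum_Suc)
  next
    fix b :: nat
    assume *: "\<forall>b::nat. \<exists>n. birkhoff_sum f n y > b"
    obtain c :: nat where c: "b + f y \<le> c" using real_arch_simple by blast
    obtain n where n: "birkhoff_sum f n y > c" using * by blast
    \<comment> \<open>The empty sum 0 does not exceed the natural number \<open>c\<close>, so
      \<open>n\<close> is positive and the first term can be split off.\<close>
    then obtain m where "n = Suc m"
      by (cases n) (auto simp: birkhoff_sum_def)
    with c n show "\<exists>n. birkhoff_sum f n (T y) > b"
      by (intro exI[of _ m]) (simp add: birkhoff_sum_Suc)
  qed
  have "T -` E \<inter> space M = E"
    using measurable_space[OF T_measurable] unfolding E_def by (auto simp: shift)
  moreover have "prob E \<noteq> 1"
  proof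
    assume "prob E = 1"
    then have "AE y in M. y \<in> E"
      by (simp add: AE_prob_1)
    then have "AE y in M. \<exists>n. 0 < birkhoff_sum f n y"
    proof eventually_elim
      case (elim y)
      then have "\<exists>n. birkhoff_sum f n y > real 0"
        unfolding E_def by blast
      then show ?case by simp
    qed
    then show False
      using integral_nonneg_if_sums_positive[OF f K] neg by simp
  qed
  ultimately have "prob E = 0"
    using ergodic[OF E] by blast
  then have "AE y in M. y \<notin> E"
    by (simp add: AE_iff_null_sets[OF E, symmetric] null_sets_def emeasure_eq_measure)
  with AE_space show ?thesis
    by eventually_elim (auto simp: E_def not_less)
qed

text \<open>Subtracting \<open>c m\<close>, slightly more than the mean, makes the integral
  negative. The sums of the difference are then bounded above, so their averages have upper limit at
  most 0.\<close>

lemma birkhoff_upper: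
  assumes [measurable]: "f \<in> borel_measurable M" and K: "\<And>y. \<bar>f y\<bar> \<le> K"
  shows "AE y in M. \<forall>e>0. \<forall>\<^sub>F n in sequentially. birkhoff_sum f n y / n \<le> (\<integral>y. f y \<partial>M) + e"
proof -
  let ?I = "\<integral>y. f y \<partial>M"
  define c where "c m = ?I + inverse (real (Suc m))" for m
  have "AE y in M. \<exists>b::nat. \<forall>n. birkhoff_sum (\<lambda>y. f y - c m) n y \<le> b" for m
  proof (rule sums_bounded_above[where K = "K + \<bar>c m\<bar>"])
    show "\<bar>f y - c m\<bar> \<le> K + \<bar>c m\<bar>" for y
      using K[of y] by linarith
    have "integrable M f"
      using K by (intro integrable_const_bound[where B = K]) auto
    then show "(\<integral>y. f y - c m \<partial>M) < 0"
      by (simp add: c_def prob_space)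
  qed measurable
  then have "AE y in M. \<forall>m. \<exists>b::nat. \<forall>n. birkhoff_sum (\<lambda>y. f y - c m) n y \<le> b"
    by (simp add: AE_all_countable)
  then show ?thesis
  proof eventually_elim
    fix y assume *: "\<forall>m. \<exists>b::nat. \<forall>n. birkhoff_sum (\<lambda>y. f y - c m) n y \<le> b"
    show "\<forall>e>0. \<forall>\<^sub>F n in sequentially. birkhoff_sum f n y / n \<le> ?I + e"
    proof (intro allI impI)
      fix e :: real assume "e > 0"
      \<comment> \<open>One half of \<open>e\<close> pays for the excess of \<open>c m\<close> over
        the mean, the other half for \<open>b / n\<close>.\<close>
      then obtain m where m: "inverse (real (Suc m)) < e / 2"
        using reals_Archimedean[of "e / 2"] by auto
      obtain b :: nat where b: "\<And>n. birkhoff_sum (\<lambda>y. f y - c m) n y \<le> b"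
        using * by blast
      obtain N :: nat where N: "2 * b / e \<le> N"
        using real_arch_simple by blast
      show "\<forall>\<^sub>F n in sequentially. birkhoff_sum f n y / n \<le> ?I + e"
        unfolding eventually_sequentially
      proof (intro exI allI impI)
        fix n assume n: "Suc N \<le> n"
        have "birkhoff_sum f n y - n * c m \<le> b"
          using b[of n] by (simp add: birkhoff_sum_def sum_subtractf)
        moreover have "b \<le> n * (e / 2)"
        proof -
          have "2 * b / e \<le> n" using N n by linarith
          then show ?thesis using \<open>e > 0\<close> by (simp add: field_simps)
        qed
        moreover have "n * c m \<le> n * (?I + e / 2)"
          using m by (intro mult_left_mono) (auto simp: c_def)
        ultimately have "birkhoff_sum f n y \<le> n * (?I + e)"
          by (simp add: algebra_simps)
        then show "birkhoff_sum f n y / n \<le> ?I + e"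
          using n by (simp add: field_simps)
      qed
    qed
  qed
qed

text \<open>The lower bound is the upper bound for \<open>- f\<close>.\<close>

lemma birkhoff_bounded:
  assumes f[measurable]: "f \<in> borel_measurable M" and K: "\<And>y. \<bar>f y\<bar> \<le> K"
  shows "AE y in M. (\<lambda>n. birkhoff_sum f n y / n) \<longlonglongrightarrow> (\<integral>y. f y \<partial>M)"
proof -
  have "AE y in M. \<forall>e>0. \<forall>\<^sub>F n in sequentially.
      birkhoff_sum (\<lambda>y. - f y) n y / n \<le> (\<integral>y. - f y \<partial>M) + e"
    by (rule birkhoff_upper[where K = K]) (use K in auto)
  with birkhoff_upper[OF f K] show ?thesis
  proof eventually_elim
    fix y
    assume 1: "\<forall>e>0. \<forall>\<^sub>F n in sequentially. birkhoff_sum f n y / n \<le> (\<integral>y. f y \<partial>M) + e"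
      and 2: "\<forall>e>0. \<forall>\<^sub>F n in sequentially.
        birkhoff_sum (\<lambda>y. - f y) n y / n \<le> (\<integral>y. - f y \<partial>M) + e"
    show "(\<lambda>n. birkhoff_sum f n y / n) \<longlonglongrightarrow> (\<integral>y. f y \<partial>M)"
    proof (rule tendstoI)
      fix e :: real assume "e > 0"
      then have "\<forall>\<^sub>F n in sequentially. birkhoff_sum f n y / n \<le> (\<integral>y. f y \<partial>M) + e / 2"
        "\<forall>\<^sub>F n in sequentially. birkhoff_sum (\<lambda>y. - f y) n y / n \<le> (\<integral>y. - f y \<partial>M) + e / 2"
        using 1 2 half_gt_zero by blast+
      then show "\<forall>\<^sub>F n in sequentially. dist (birkhoff_sum f n y / n) (\<integral>y. f y \<partial>M) < e"
      proof eventually_elim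
        case (elim n)
        then show ?case
          using \<open>e > 0\<close> by (simp add: birkhoff_sum_def sum_negf dist_real_def)
      qed
    qed
  qed
qed

section \<open>Recurrence and hitting times\<close>

lemma recurrence:
  assumes A[measurable]: "A \<in> sets M" and pos: "0 < prob A"
  shows "AE y in M. \<exists>k. (T ^^ k) y \<in> A"
proof -
  \<comment> \<open>Points that visit \<open>A\<close> at time \<open>n\<close> or later. The
    preimage of \<open>V n\<close> is \<open>V (Suc n)\<close>, so all these decreasing sets have
    the same measure. Their intersection is invariant and has the measure of \<open>V 0\<close>,
    which is positive because \<open>V 0\<close> contains \<open>A\<close>; ergodicity makes it
    1.\<close>
  define V where "V n = {y \<in> space M. \<exists>k\<ge>n. (T ^^ k) y \<in> A}" for n
  have V[measurable]: "V n \<in> sets M" for n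
    unfolding V_def by measurable
  have Tsp: "T y \<in> space M" if "y \<in> space M" for y
    using measurable_space[OF T_measurable that] .
  have step: "T -` V n \<inter> space M = V (Suc n)" for n
  proof
    show "T -` V n \<inter> space M \<subseteq> V (Suc n)"
      by (auto simp: V_def funpow_swap1 intro!: exI[of _ "Suc _"])
    show "V (Suc n) \<subseteq> T -` V n \<inter> space M"
    proof
      fix y assume "y \<in> V (Suc n)"
      then obtain k where k: "y \<in> space M" "Suc n \<le> k" "(T ^^ k) y \<in> A"
        by (auto simp: V_def)
      then obtain j where "k = Suc j" by (cases k) auto
      with k show "y \<in> T -` V n \<inter> space M"
        by (auto simp: V_def funpow_swap1 Tsp)
    qed
  qed
  have dec: "V (Suc n) \<subseteq> V n" for n
    by (auto simp: V_def intro: Suc_leD)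
  have same: "prob (V n) = prob (V 0)" for n
    using measure_vimage_T[OF V] by (induction n) (simp_all add: step)
  let ?W = "\<Inter>n. V n"
  have "(\<lambda>n. prob (V n)) \<longlonglongrightarrow> prob ?W"
    by (rule finite_Lim_measure_decseq) (auto intro!: decseq_SucI dec)
  then have W: "prob ?W = prob (V 0)"
    by (subst (asm) same) (simp add: LIMSEQ_const_iff)
  have "T -` ?W \<inter> space M = (\<Inter>n. V (Suc n))"
    using step by blast
  also have "\<dots> = ?W"
    using dec by blast
  finally have "prob ?W = 0 \<or> prob ?W = 1"
    by (intro ergodic) measurable
  moreover have "prob A \<le> prob (V 0)"
    using sets.sets_into_space[OF A]
    by (intro finite_measure_mono) (auto simp: V_def intro!: exI[of _ "0::nat"])
  ultimately have "prob (V 0) = 1"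
    using pos W by auto
  then have "AE y in M. y \<in> V 0"
    by (simp add: AE_prob_1)
  then show ?thesis
    by eventually_elim (auto simp: V_def)
qed

text \<open>The function \<open>\<kappa>\<close> is the time until the first visit to a small set. It takes the place of the
  height function of a Rokhlin tower.\<close>

lemma exists_hitting_time:
  assumes "nonatomic M" "0 < e"
  obtains \<kappa> :: "'a \<Rightarrow> nat" where "\<kappa> \<in> measurable M (count_space UNIV)"
    "prob {y \<in> space M. \<kappa> y = 0} < e"
    "\<And>y. 0 < \<kappa> y \<Longrightarrow> \<kappa> (T y) = \<kappa> y - 1"
proof -
  obtain A where A[measurable]: "A \<in> sets M" and pos: "0 < prob A" and small: "prob A < e"
    using exists_small_set[OF assms] by blast
  \<comment> \<open>Points that never reach \<open>A\<close> get the value 0. By recurrence they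
    form a null set, so level 0 still has the measure of \<open>A\<close>; and as the step rule
    speaks only of positive values, it holds at every point.\<close>
  define \<kappa> where "\<kappa> y = (if \<exists>k. (T ^^ k) y \<in> A then LEAST k. (T ^^ k) y \<in> A else 0)" for y
  have "\<kappa> \<in> measurable M (count_space UNIV)"
    unfolding \<kappa>_def[abs_def] by measurable
  moreover from this have "prob {y \<in> space M. \<kappa> y = 0} = prob A"
  proof (intro measure_eq_AE)
    show "AE y in M. (y \<in> {y \<in> space M. \<kappa> y = 0}) = (y \<in> A)"
      using recurrence[OF A pos] AE_space
    proof eventually_elim
      case (elim y)
      then show ?case
        using LeastI_ex[OF elim(1)] Least_le[of "\<lambda>k. (T ^^ k) y \<in> A" 0]
        by (auto simp: \<kappa>_def)
    qed
  qed auto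
  moreover have "\<kappa> (T y) = \<kappa> y - 1" if "0 < \<kappa> y" for y
  proof -
    have ex: "\<exists>k. (T ^^ k) y \<in> A" and \<kappa>: "\<kappa> y = (LEAST k. (T ^^ k) y \<in> A)"
      using that by (auto simp: \<kappa>_def split: if_splits)
    from that obtain j where j: "\<kappa> y = Suc j"
      using gr0_conv_Suc by blast
    have hit: "(T ^^ j) (T y) \<in> A"
      using LeastI_ex[OF ex] by (simp add: \<kappa>[symmetric] j funpow_swap1)
    have "j \<le> i" if "(T ^^ i) (T y) \<in> A" for i
    proof -
      have "(T ^^ Suc i) y \<in> A" using that by (simp add: funpow_swap1)
      from Least_le[of "\<lambda>k. (T ^^ k) y \<in> A", OF this] show ?thesis
        by (simp add: \<kappa>[symmetric] j)
    qed
    with hit have "(LEAST k. (T ^^ k) (T y) \<in> A) = j"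
      by (intro Least_equality) auto
    with hit show ?thesis
      by (auto simp: \<kappa>_def[of "T y"] j)
  qed
  ultimately show thesis
    using small that by auto
qed

end

section \<open>Haar measure\<close>

lemma borel_measurable_uminus_group [measurable (raw)]:
  fixes f :: "'a \<Rightarrow> 'g::{topological_group_add, second_countable_topology}"
  assumes "f \<in> borel_measurable M"
  shows "(\<lambda>x. - f x) \<in> borel_measurable M"
proof (rule borel_measurable_continuous_on[OF _ assms])
  show "continuous_on UNIV (\<lambda>x::'g. - x)"
    unfolding continuous_on_def by (auto intro: tendsto_intros)
qed

lemma borel_measurable_diff_group [measurable (raw)]:
  fixes f g :: "'a \<Rightarrow> 'g::{topological_group_add, second_countable_topology}"
  assumes [measurable]: "f \<in> borel_measurable M" "g \<in> borel_measurable M"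
  shows "(\<lambda>x. f x - g x) \<in> borel_measurable M"
  unfolding diff_conv_add_uminus by measurable

locale haar = prob_space L for L :: "'g::{topological_group_add, second_countable_topology} measure" +
  assumes sets_L [measurable_cong]: "sets L = sets borel"
    and left_invariant: "A \<in> sets borel \<Longrightarrow> emeasure L ((+) g ` A) = emeasure L A"
begin

lemma space_L [simp]: "space L = UNIV"
  using sets_eq_imp_space_eq[OF sets_L] by simp

lemma prob_UNIV [simp]: "prob UNIV = 1"
  using prob_space by simp

lemma distr_left: "distr L borel ((+) g) = L"
proof (rule measure_eqI)
  fix A assume "A \<in> sets (distr L borel ((+) g))"
  then have A: "A \<in> sets borel" by simp
  have "(+) g -` A = (+) (- g) ` A"
    by (force simp: image_iff add.assoc[symmetric])
  then show "emeasure (distr L borel ((+) g)) A = emeasure L A"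
    using A left_invariant[OF A, of "- g"] by (simp add: emeasure_distr)
qed (simp add: sets_L)

lemma integral_left:
  fixes f :: "'g \<Rightarrow> real"
  assumes [measurable]: "f \<in> borel_measurable borel"
  shows "(\<integral>x. f (g + x) \<partial>L) = (\<integral>x. f x \<partial>L)"
proof -
  have "(\<integral>x. f x \<partial>distr L borel ((+) g)) = (\<integral>x. f (g + x) \<partial>L)"
    by (rule integral_distr) measurable
  then show ?thesis by (simp add: distr_left)
qed

lemma integrable_bounded:
  fixes f :: "'g \<Rightarrow> real"
  assumes "f \<in> borel_measurable borel" "\<And>x. \<bar>f x\<bar> \<le> K"
  shows "integrable L f"
  using assms by (intro integrable_const_bound[where B = K]) (auto simp: measurable_cong_sets[OF sets_L refl])

text \<open>Uniqueness of Haar measure: the reflected measure is right invariant, and integrating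
  \<open>f (- x + y)\<close> in both orders identifies it with the left invariant one.\<close>

lemma integral_uminus:
  fixes f :: "'g \<Rightarrow> real"
  assumes [measurable]: "f \<in> borel_measurable borel" and K: "\<And>x. \<bar>f x\<bar> \<le> K"
  shows "(\<integral>x. f (- x) \<partial>L) = (\<integral>x. f x \<partial>L)"
proof -
  interpret P: pair_prob_space L L ..
  have int: "integrable (L \<Otimes>\<^sub>M L) (\<lambda>(x, y). f (- x + y))"
    by (intro P.P.integrable_const_bound[where B = K]) (auto simp: K)
  have "(\<integral>x. f x \<partial>L) = (\<integral>x. (\<integral>y. f (- x + y) \<partial>L) \<partial>L)"
    by (subst integral_left) (auto simp: prob_space)
  also have "\<dots> = (\<integral>y. (\<integral>x. f (- x + y) \<partial>L) \<partial>L)"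
    using P.Fubini_integral[OF int] by simp
  also have "\<dots> = (\<integral>y. (\<integral>x. f (- x) \<partial>L) \<partial>L)"
  proof (rule Bochner_Integration.integral_cong[OF refl])
    fix y
    \<comment> \<open>Since \<open>- x + y = - (- y + x)\<close>, the left translation by
      \<open>- y\<close> removes the dependence on \<open>y\<close>.\<close>
    have "(\<integral>x. f (- x) \<partial>L) = (\<integral>x. f (- (- y + x)) \<partial>L)"
      by (rule integral_left[symmetric]) measurable
    then show "(\<integral>x. f (- x + y) \<partial>L) = (\<integral>x. f (- x) \<partial>L)"
      by (simp add: minus_add)
  qed
  finally show ?thesis by (simp add: prob_space)
qed

text \<open>Reflection exchanges the two kinds of translation: \<open>- x + g = - (- g + x)\<close>,
  so left invariance is applied between two uses of \<open>integral_uminus\<close>.\<close>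

lemma integral_right:
  fixes f :: "'g \<Rightarrow> real"
  assumes [measurable]: "f \<in> borel_measurable borel" and K: "\<And>x. \<bar>f x\<bar> \<le> K"
  shows "(\<integral>x. f (x + g) \<partial>L) = (\<integral>x. f x \<partial>L)"
proof -
  have "(\<integral>x. f (x + g) \<partial>L) = (\<integral>x. f (- x + g) \<partial>L)"
    by (rule integral_uminus[symmetric, where K = K]) (auto simp: K)
  also have "\<dots> = (\<integral>x. f (- (- g + x)) \<partial>L)"
    by (simp add: minus_add)
  also have "\<dots> = (\<integral>x. f (- x) \<partial>L)"
    by (rule integral_left) measurable
  also have "\<dots> = (\<integral>x. f x \<partial>L)"
    by (rule integral_uminus[OF assms])
  finally show ?thesis .
qed

end

text \<open>A derandomised second-moment estimate: for independent random \<open>x i\<close> the cross terms have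
  mean zero, so they can be made nonpositive by choosing the \<open>x i\<close> one after the other.\<close>

lemma (in prob_space) exists_small_second_moment:
  fixes D :: "nat \<Rightarrow> 'a \<Rightarrow> 'a \<Rightarrow> real"
  assumes meas: "\<And>i. (\<lambda>(x, g). D i x g) \<in> borel_measurable (M \<Otimes>\<^sub>M M)"
    and bound: "\<And>i x g. \<bar>D i x g\<bar> \<le> a i"
    and mean: "\<And>i g. g \<in> space M \<Longrightarrow> (\<integral>x. D i x g \<partial>M) = 0"
  shows "\<exists>x. (\<forall>i. x i \<in> space M) \<and> (\<integral>g. (\<Sum>i<n. D i (x i) g)\<^sup>2 \<partial>M) \<le> (\<Sum>i<n. (a i)\<^sup>2)"
proof (induction n)
  case 0
  show ?case using not_empty by auto
next
  case (Suc n)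
  interpret P: pair_prob_space M M ..
  from Suc obtain x where x: "\<And>i. x i \<in> space M"
    and IH: "(\<integral>g. (\<Sum>i<n. D i (x i) g)\<^sup>2 \<partial>M) \<le> (\<Sum>i<n. (a i)\<^sup>2)" by blast
  have Dm[measurable]: "D i y \<in> borel_measurable M" if "y \<in> space M" for i y
    using measurable_compose[OF measurable_Pair1'[OF that] meas[of i]] by simp
  define S where "S g = (\<Sum>i<n. D i (x i) g)" for g
  have S[measurable]: "S \<in> borel_measurable M"
    unfolding S_def[abs_def] by (intro borel_measurable_sum Dm x)
  define A where "A = (\<Sum>i<n. a i)"
  have SA: "\<bar>S g\<bar> \<le> A" for g
    unfolding S_def A_def using bound by (intro order.trans[OF sum_abs] sum_mono)
  have a0: "0 \<le> a i" for i
    using bound[of i undefined undefined] by linarith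
  have A0: "0 \<le> A" unfolding A_def by (intro sum_nonneg a0)
  have SD: "\<bar>S g * D n y g\<bar> \<le> A * a n" for g y
    unfolding abs_mult by (intro mult_mono SA bound A0) simp
  \<comment> \<open>Half of the cross term that arises if \<open>y\<close> is chosen for index
    \<open>n\<close>. Its mean over \<open>y\<close> is zero by Fubini and \<open>mean\<close>, so
    some \<open>y\<close> makes it nonpositive.\<close>
  define J where "J y = (\<integral>g. S g * D n y g \<partial>M)" for y
  note meas[measurable]
  have int: "integrable (M \<Otimes>\<^sub>M M) (\<lambda>(y, g). S g * D n y g)"
  proof (intro P.P.integrable_const_bound[where B = "A * a n"])
    show "(\<lambda>(y, g). S g * D n y g) \<in> borel_measurable (M \<Otimes>\<^sub>M M)"
      using meas[of n] by (simp add: split_beta')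
  qed (use SD in auto)
  have "(\<integral>y. J y \<partial>M) = (\<integral>g. (\<integral>y. S g * D n y g \<partial>M) \<partial>M)"
    using P.Fubini_integral[OF int] by (simp add: J_def)
  also have "\<dots> = (\<integral>g. 0 \<partial>M)"
    by (rule Bochner_Integration.integral_cong) (auto simp: mean)
  finally have J0: "(\<integral>y. J y \<partial>M) = 0" by simp
  have "integrable M J"
    using P.integrable_fst'[OF int] by (simp add: J_def[abs_def])
  have "\<exists>y\<in>space M. J y \<le> 0"
  proof (rule ccontr)
    assume "\<not> ?thesis"
    then have "(\<integral>y. - J y \<partial>M) < 0"
      using \<open>integrable M J\<close> by (intro expectation_less) (auto simp: not_le)
    then show False using J0 by simp
  qed
  then obtain y where y: "y \<in> space M" "J y \<le> 0" by blast
  have [measurable]: "D n y \<in> borel_measurable M" by (rule Dm[OF y(1)])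
  have i1: "integrable M (\<lambda>g. (S g)\<^sup>2)"
    by (intro integrable_const_bound[where B = "A\<^sup>2"]) (auto intro!: AE_I2 simp: power2_le_iff_abs_le A0 SA)
  have i2: "integrable M (\<lambda>g. (D n y g)\<^sup>2)"
    by (intro integrable_const_bound[where B = "(a n)\<^sup>2"]) (auto intro!: AE_I2 simp: power2_le_iff_abs_le a0 bound)
  have i3: "integrable M (\<lambda>g. S g * D n y g)"
    by (intro integrable_const_bound[where B = "A * a n"]) (use SD in auto)
  have "(\<integral>g. (D n y g)\<^sup>2 \<partial>M) \<le> (\<integral>g. (a n)\<^sup>2 \<partial>M)"
    by (intro integral_mono i2) (auto simp: power2_le_iff_abs_le a0 bound)
  then have D2: "(\<integral>g. (D n y g)\<^sup>2 \<partial>M) \<le> (a n)\<^sup>2"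
    by (simp add: prob_space)
  let ?x = "x(n := y)"
  have "(\<integral>g. (\<Sum>i<Suc n. D i (?x i) g)\<^sup>2 \<partial>M) = (\<integral>g. (S g)\<^sup>2 + 2 * (S g * D n y g) + (D n y g)\<^sup>2 \<partial>M)"
    by (intro Bochner_Integration.integral_cong) (auto simp: S_def power2_sum)
  also have "\<dots> = (\<integral>g. (S g)\<^sup>2 \<partial>M) + 2 * J y + (\<integral>g. (D n y g)\<^sup>2 \<partial>M)"
    using i1 i2 i3 by (simp add: J_def)
  also have "\<dots> \<le> (\<Sum>i<Suc n. (a i)\<^sup>2)"
    using IH D2 y by (simp add: S_def)
  finally show ?case
    using x y(1) by (intro exI[of _ ?x]) auto
qed

section \<open>Skew products over coboundaries\<close>

text \<open>Later values stand further to the left: the group need not be commutative, and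
  \<open>skew_product\<close> adds from the left.\<close>

primrec cocycle_sum :: "('a \<Rightarrow> 'a) \<Rightarrow> ('a \<Rightarrow> 'g::topological_group_add) \<Rightarrow> nat \<Rightarrow> 'a \<Rightarrow> 'g" where
  "cocycle_sum T \<phi> 0 y = 0"
| "cocycle_sum T \<phi> (Suc k) y = cocycle_sum T \<phi> k (T y) + \<phi> y"

lemma skew_product_funpow:
  "(skew_product T \<phi> ^^ k) (y, g) = ((T ^^ k) y, cocycle_sum T \<phi> k y + g)"
proof (induction k arbitrary: y g)
  case (Suc k)
  have "(skew_product T \<phi> ^^ Suc k) (y, g) = (skew_product T \<phi> ^^ k) (T y, \<phi> y + g)"
    by (simp add: funpow_swap1 skew_product_def)
  then show ?case
    using Suc[of "T y" "\<phi> y + g"] by (simp add: funpow_swap1 add.assoc)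
qed simp

lemma cocycle_sum_coboundary:
  "cocycle_sum T (\<lambda>y. w (T y) - w y) k y = w ((T ^^ k) y) - w y"
proof (induction k arbitrary: y)
  case (Suc k)
  show ?case
    by (simp add: Suc[of "T y"] funpow_swap1 add_diff_eq)
qed simp

lemma cocycle_sum_measurable:
  fixes \<phi> :: "'a \<Rightarrow> 'g::{topological_group_add, second_countable_topology}"
  assumes [measurable]: "T \<in> measurable M M" "\<phi> \<in> borel_measurable M"
  shows "cocycle_sum T \<phi> k \<in> borel_measurable M"
proof (induction k)
  case (Suc k)
  note [measurable] = Suc
  show ?case unfolding cocycle_sum.simps[abs_def] by measurable
qed (simp add: cocycle_sum.simps[abs_def])

text \<open>\<open>T\<close> maps residue class \<open>Suc j\<close> into class \<open>j\<close>, so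
  the measures of the classes decrease with the residue. A positive multiple of \<open>Q\<close>
  goes to residue \<open>Q - 1\<close>; hence class 0 exceeds class \<open>Q - 1\<close>, the
  smallest of \<open>Q\<close> disjoint classes, by at most the measure of level 0.\<close>

lemma (in mpt) hitting_time_residue:
  assumes \<kappa>[measurable]: "\<kappa> \<in> measurable M (count_space UNIV)"
    and \<kappa>0: "prob {y \<in> space M. \<kappa> y = 0} \<le> e"
    and step: "\<And>y. 0 < \<kappa> y \<Longrightarrow> \<kappa> (T y) = \<kappa> y - 1"
    and Q: "j < (Q::nat)"
  shows "prob {y \<in> space M. \<kappa> y mod Q = j} \<le> 1 / Q + e"
proof -
  define F where "F j = {y \<in> space M. \<kappa> y mod Q = j}" for j
  have F[measurable]: "F j \<in> sets M" for j unfolding F_def by measurable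
  have "0 < Q" using Q by simp
  have Tsp: "T y \<in> space M" if "y \<in> space M" for y
    using measurable_space[OF T_measurable that] .
  have "prob (F (Suc j)) \<le> prob (F j)" if "Suc j < Q" for j
  proof -
    have "F (Suc j) \<subseteq> T -` F j \<inter> space M"
    proof
      fix y assume y: "y \<in> F (Suc j)"
      then have "0 < \<kappa> y" using that by (cases "\<kappa> y") (auto simp: F_def)
      then obtain m where m: "\<kappa> y = Suc m" using gr0_conv_Suc by blast
      then have "m mod Q = j" using y that by (auto simp: F_def mod_Suc split: if_splits)
      then show "y \<in> T -` F j \<inter> space M"
        using step[OF \<open>0 < \<kappa> y\<close>] m y by (auto simp: F_def Tsp)
    qed
    then have "prob (F (Suc j)) \<le> prob (T -` F j \<inter> space M)"
      by (intro finite_measure_mono) auto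
    then show ?thesis by (simp add: measure_vimage_T)
  qed
  then have dec: "prob (F j) \<le> prob (F i)" if "i \<le> j" "j < Q" for i j
    using that
  proof (induction j)
    case (Suc j)
    then show ?case
      using Suc.IH by (cases "i = Suc j") (auto intro: order.trans)
  qed simp
  have "F 0 \<subseteq> {y \<in> space M. \<kappa> y = 0} \<union> (T -` F (Q - 1) \<inter> space M)"
  proof
    fix y assume y: "y \<in> F 0"
    show "y \<in> {y \<in> space M. \<kappa> y = 0} \<union> (T -` F (Q - 1) \<inter> space M)"
    proof (cases "\<kappa> y = 0")
      case False
      then obtain m where m: "\<kappa> y = Suc m" using not0_implies_Suc by blast
      then have "m mod Q = Q - 1" using y by (auto simp: F_def mod_Suc split: if_splits)
      then show ?thesis
        using step[of y] m y by (auto simp: F_def Tsp)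
    qed (use y in \<open>auto simp: F_def\<close>)
  qed
  then have "prob (F 0) \<le> prob ({y \<in> space M. \<kappa> y = 0} \<union> (T -` F (Q - 1) \<inter> space M))"
    by (intro finite_measure_mono) auto
  also have "\<dots> \<le> prob {y \<in> space M. \<kappa> y = 0} + prob (T -` F (Q - 1) \<inter> space M)"
    by (intro measure_Un_le) auto
  finally have F0: "prob (F 0) \<le> e + prob (F (Q - 1))"
    using \<kappa>0 by (simp add: measure_vimage_T)
  have "Q * prob (F (Q - 1)) = (\<Sum>j<Q. prob (F (Q - 1)))"
    by simp
  also have "\<dots> \<le> (\<Sum>j<Q. prob (F j))"
    by (intro sum_mono dec) auto
  also have "\<dots> = prob (\<Union>j<Q. F j)"
    by (intro finite_measure_finite_Union[symmetric]) (auto simp: disjoint_family_on_def F_def)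
  also have "\<dots> \<le> 1" by simp
  finally have "prob (F (Q - 1)) \<le> 1 / Q"
    using \<open>0 < Q\<close> by (simp add: field_simps)
  moreover have "prob (F j) \<le> prob (F 0)" using dec Q by simp
  ultimately show ?thesis using F0 by (simp add: F_def)
qed

lemma average_bounds:
  fixes f :: "'b \<Rightarrow> real" and n :: nat
  assumes f: "\<And>p. 0 \<le> f p" "\<And>p. f p \<le> 1" and c: "0 \<le> c" "c \<le> 1"
  shows "\<bar>(\<Sum>k<n. f (q k)) / n - c\<bar> \<le> 1"
proof -
  have "(\<Sum>k<n. f (q k)) \<le> n"
    using sum_mono[of "{..<n}" "\<lambda>k. f (q k)" "\<lambda>_. 1"] f by simp
  moreover have "0 \<le> (\<Sum>k<n. f (q k))"
    by (intro sum_nonneg f)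
  ultimately have "0 \<le> (\<Sum>k<n. f (q k)) / n" "(\<Sum>k<n. f (q k)) / n \<le> 1"
    by (auto simp: divide_le_eq_1)
  then show ?thesis using c by linarith
qed

section \<open>Averages along skew products, and their limits for coboundaries\<close>

locale skew_base = Y: ergodic_mpt \<nu> T + G: haar L
  for \<nu> :: "'a measure" and T
    and L :: "'g::{topological_group_add, second_countable_topology} measure"
begin

sublocale P: pair_prob_space \<nu> L ..

abbreviation "P \<equiv> \<nu> \<Otimes>\<^sub>M L"

lemma skew_measurable [measurable]:
  assumes [measurable]: "\<phi> \<in> borel_measurable \<nu>"
  shows "skew_product T \<phi> \<in> measurable P P"
  unfolding skew_product_def by measurable

text \<open>On each fibre the map is a left translation, so the fibre of the preimage over
  \<open>y\<close> has the measure of the fibre of \<open>A\<close> over \<open>T y\<close>.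
  Integrating over the base, \<open>T\<close> preserves the result.\<close>

lemma distr_skew:
  assumes [measurable]: "\<phi> \<in> borel_measurable \<nu>"
  shows "distr P P (skew_product T \<phi>) = P"
proof (rule measure_eqI)
  fix A assume "A \<in> sets (distr P P (skew_product T \<phi>))"
  then have A[measurable]: "A \<in> sets P" by simp
  have h: "(\<lambda>y. emeasure L (Pair y -` A)) \<in> borel_measurable \<nu>"
    by (rule G.measurable_emeasure_Pair[OF A])
  have "emeasure (distr P P (skew_product T \<phi>)) A = emeasure P (skew_product T \<phi> -` A \<inter> space P)"
    by (simp add: emeasure_distr)
  also have "\<dots> = (\<integral>\<^sup>+y. emeasure L (Pair y -` (skew_product T \<phi> -` A \<inter> space P)) \<partial>\<nu>)"
    by (rule G.emeasure_pair_measure_alt) measurable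
  also have "\<dots> = (\<integral>\<^sup>+y. emeasure L (Pair (T y) -` A) \<partial>\<nu>)"
  proof (rule nn_integral_cong)
    fix y assume y: "y \<in> space \<nu>"
    have Ay: "Pair (T y) -` A \<in> sets borel"
      using sets_Pair1[OF A] by (simp add: G.sets_L)
    have "Pair y -` (skew_product T \<phi> -` A \<inter> space P) = (+) (\<phi> y) -` (Pair (T y) -` A) \<inter> space L"
      using y by (auto simp: skew_product_def space_pair_measure)
    also have "emeasure L \<dots> = emeasure (distr L borel ((+) (\<phi> y))) (Pair (T y) -` A)"
      using Ay by (intro emeasure_distr[symmetric]) auto
    finally show "emeasure L (Pair y -` (skew_product T \<phi> -` A \<inter> space P)) = emeasure L (Pair (T y) -` A)"
      by (simp add: G.distr_left)
  qed
  also have "\<dots> = (\<integral>\<^sup>+y. emeasure L (Pair y -` A) \<partial>distr \<nu> \<nu> T)"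
    using h by (intro nn_integral_distr[symmetric]) auto
  also have "\<dots> = emeasure P A"
    by (simp add: Y.distr_T G.emeasure_pair_measure_alt[OF A])
  finally show "emeasure (distr P P (skew_product T \<phi>)) A = emeasure P A" .
qed simp

text \<open>The error is taken in mean rather than pointwise, so that for fixed \<open>n\<close> and
  Lipschitz \<open>f\<close> it varies continuously with the cocycle; see
  \<open>avg_err_lipschitz\<close>.\<close>

definition avg_err :: "('a \<Rightarrow> 'g) \<Rightarrow> nat \<Rightarrow> ('a \<times> 'g \<Rightarrow> real) \<Rightarrow> real" where
  "avg_err \<phi> n f = (\<integral>p. \<bar>(\<Sum>k<n. f ((skew_product T \<phi> ^^ k) p)) / n - (\<integral>p. f p \<partial>P)\<bar> \<partial>P)"

lemma integral_bounds:
  fixes f :: "'a \<times> 'g \<Rightarrow> real"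
  assumes [measurable]: "f \<in> borel_measurable P" and f: "\<And>p. 0 \<le> f p" "\<And>p. f p \<le> 1"
  shows "0 \<le> (\<integral>p. f p \<partial>P)" "(\<integral>p. f p \<partial>P) \<le> 1"
proof -
  show "0 \<le> (\<integral>p. f p \<partial>P)" using f by simp
  have "(\<integral>p. f p \<partial>P) \<le> (\<integral>p. 1 \<partial>P)"
    using f by (intro integral_mono P.P.integrable_const_bound[where B = 1]) auto
  then show "(\<integral>p. f p \<partial>P) \<le> 1" by (simp add: P.P.prob_space)
qed

text \<open>For a coboundary, the change of variables \<open>g \<mapsto> w y + g\<close> turns the skew product into
  \<open>T \<times> id\<close>.\<close>

lemma avg_err_coboundary:
  assumes [measurable]: "w \<in> borel_measurable \<nu>"
    and f_meas[measurable]: "f \<in> borel_measurable P" and f: "\<And>p. 0 \<le> f p" "\<And>p. f p \<le> 1"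
  shows "avg_err (\<lambda>y. w (T y) - w y) n f =
    (\<integral>g. (\<integral>y. \<bar>Y.birkhoff_sum (\<lambda>z. f (z, w z + g)) n y / n - (\<integral>p. f p \<partial>P)\<bar> \<partial>\<nu>) \<partial>L)"
proof -
  define c where "c = (\<integral>p. f p \<partial>P)"
  have c: "0 \<le> c" "c \<le> 1"
    unfolding c_def using integral_bounds[OF f_meas f] by auto
  define h where "h y g = \<bar>(\<Sum>k<n. f ((T ^^ k) y, w ((T ^^ k) y) + g)) / n - c\<bar>" for y g
  have h_meas: "(\<lambda>(y, g). h y g) \<in> borel_measurable P"
    unfolding h_def by measurable
  have h1: "\<bar>h y g\<bar> \<le> 1" for y g
    unfolding h_def abs_abs by (rule average_bounds[OF f c])
  have skew: "\<bar>(\<Sum>k<n. f ((skew_product T (\<lambda>y. w (T y) - w y) ^^ k) (y, g))) / n - c\<bar> =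
      h y (- w y + g)" for y g
    unfolding h_def skew_product_funpow cocycle_sum_coboundary
    by (simp add: add.assoc[symmetric])
  have int: "integrable P (\<lambda>(y, g). h y (- w y + g))" "integrable P (\<lambda>(y, g). h y g)"
    using h1 h_meas
    by (auto intro!: P.P.integrable_const_bound[where B = 1] measurable_compose[OF _ h_meas, of "\<lambda>(y, g). (y, - w y + g)", simplified split_beta' prod.case fst_conv snd_conv] simp: split_beta')
  have "avg_err (\<lambda>y. w (T y) - w y) n f = (\<integral>p. (case p of (y, g) \<Rightarrow> h y (- w y + g)) \<partial>P)"
    unfolding avg_err_def c_def[symmetric]
    by (intro Bochner_Integration.integral_cong) (auto simp: skew)
  also have "\<dots> = (\<integral>y. (\<integral>g. h y (- w y + g) \<partial>L) \<partial>\<nu>)"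
    using P.integral_fst'[OF int(1)] by simp
  also have "\<dots> = (\<integral>y. (\<integral>g. h y g \<partial>L) \<partial>\<nu>)"
  proof (rule Bochner_Integration.integral_cong[OF refl])
    fix y assume y: "y \<in> space \<nu>"
    have "h y \<in> borel_measurable L"
      using measurable_compose[OF measurable_Pair1'[OF y] h_meas] by simp
    then show "(\<integral>g. h y (- w y + g) \<partial>L) = (\<integral>g. h y g \<partial>L)"
      by (intro G.integral_left) (simp add: measurable_cong_sets[OF G.sets_L refl])
  qed
  also have "\<dots> = (\<integral>g. (\<integral>y. h y g \<partial>\<nu>) \<partial>L)"
    using P.Fubini_integral[OF int(2)] by simp
  finally show ?thesis
    by (simp add: h_def c_def Y.birkhoff_sum_def)
qed

text \<open>For fixed \<open>g\<close> only Birkhoff averages on the base remain, of the bounded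
  function \<open>f (z, w z + g)\<close>. Birkhoff's theorem gives the limit in \<open>y\<close>,
  and dominated convergence is applied first in \<open>y\<close>, then in \<open>g\<close>.\<close>

lemma avg_err_coboundary_tendsto:
  assumes [measurable]: "w \<in> borel_measurable \<nu>"
    and f_meas[measurable]: "f \<in> borel_measurable P" and f: "\<And>p. 0 \<le> f p" "\<And>p. f p \<le> 1"
  shows "(\<lambda>n. avg_err (\<lambda>y. w (T y) - w y) n f) \<longlonglongrightarrow>
    (\<integral>g. \<bar>(\<integral>z. f (z, w z + g) \<partial>\<nu>) - (\<integral>p. f p \<partial>P)\<bar> \<partial>L)"
proof -
  define c where "c = (\<integral>p. f p \<partial>P)"
  have c: "0 \<le> c" "c \<le> 1"
    unfolding c_def using integral_bounds[OF f_meas f] by auto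
  have b1: "\<bar>Y.birkhoff_sum (\<lambda>z. f (z, w z + g)) n y / n - c\<bar> \<le> 1" for n y g
    unfolding Y.birkhoff_sum_def
    by (rule average_bounds[where f = f, OF f c])
  have m: "(\<lambda>z. f (z, w z + g)) \<in> borel_measurable \<nu>" for g
    by measurable
  have bm: "(\<lambda>(g, y). \<bar>Y.birkhoff_sum (\<lambda>z. f (z, w z + g)) n y / n - c\<bar>) \<in> borel_measurable (L \<Otimes>\<^sub>M \<nu>)" for n
    unfolding Y.birkhoff_sum_def by measurable
  have "(\<lambda>n. \<integral>y. \<bar>Y.birkhoff_sum (\<lambda>z. f (z, w z + g)) n y / n - c\<bar> \<partial>\<nu>)
      \<longlonglongrightarrow> (\<integral>y. \<bar>(\<integral>z. f (z, w z + g) \<partial>\<nu>) - c\<bar> \<partial>\<nu>)" for g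
  proof (rule integral_dominated_convergence[where w = "\<lambda>_. 1"])
    show "AE y in \<nu>. (\<lambda>n. \<bar>Y.birkhoff_sum (\<lambda>z. f (z, w z + g)) n y / n - c\<bar>)
        \<longlonglongrightarrow> \<bar>(\<integral>z. f (z, w z + g) \<partial>\<nu>) - c\<bar>"
      using Y.birkhoff_bounded[OF m, of g 1] f by (auto elim!: eventually_mono intro!: tendsto_intros)
    show "AE y in \<nu>. norm \<bar>Y.birkhoff_sum (\<lambda>z. f (z, w z + g)) n y / n - c\<bar> \<le> 1" for n
      using b1 by simp
    show "(\<lambda>y. \<bar>Y.birkhoff_sum (\<lambda>z. f (z, w z + g)) n y / n - c\<bar>) \<in> borel_measurable \<nu>" for n
      using Y.birkhoff_sum_measurable[OF m] by measurable
  qed auto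
  then have lim: "(\<lambda>n. \<integral>y. \<bar>Y.birkhoff_sum (\<lambda>z. f (z, w z + g)) n y / n - c\<bar> \<partial>\<nu>)
      \<longlonglongrightarrow> \<bar>(\<integral>z. f (z, w z + g) \<partial>\<nu>) - c\<bar>" for g
    by (simp add: Y.prob_space)
  have "(\<lambda>n. \<integral>g. (\<integral>y. \<bar>Y.birkhoff_sum (\<lambda>z. f (z, w z + g)) n y / n - c\<bar> \<partial>\<nu>) \<partial>L)
      \<longlonglongrightarrow> (\<integral>g. \<bar>(\<integral>z. f (z, w z + g) \<partial>\<nu>) - c\<bar> \<partial>L)"
  proof (rule integral_dominated_convergence[where w = "\<lambda>_. 1"])
    show "AE g in L. (\<lambda>n. \<integral>y. \<bar>Y.birkhoff_sum (\<lambda>z. f (z, w z + g)) n y / n - c\<bar> \<partial>\<nu>)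
        \<longlonglongrightarrow> \<bar>(\<integral>z. f (z, w z + g) \<partial>\<nu>) - c\<bar>"
      using lim by simp
    show "(\<lambda>g. \<integral>y. \<bar>Y.birkhoff_sum (\<lambda>z. f (z, w z + g)) n y / n - c\<bar> \<partial>\<nu>) \<in> borel_measurable L" for n
      using bm by (rule Y.borel_measurable_lebesgue_integral)
    show "(\<lambda>g. \<bar>(\<integral>z. f (z, w z + g) \<partial>\<nu>) - c\<bar>) \<in> borel_measurable L"
      by measurable
    show "AE g in L. norm (\<integral>y. \<bar>Y.birkhoff_sum (\<lambda>z. f (z, w z + g)) n y / n - c\<bar> \<partial>\<nu>) \<le> 1" for n
    proof (rule AE_I2)
      fix g
      have "(\<integral>y. \<bar>Y.birkhoff_sum (\<lambda>z. f (z, w z + g)) n y / n - c\<bar> \<partial>\<nu>) \<le> (\<integral>y. 1 \<partial>\<nu>)"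
        using b1 Y.birkhoff_sum_measurable[OF m]
        by (intro integral_mono Y.integrable_const_bound[where B = 1]) auto
      then show "norm (\<integral>y. \<bar>Y.birkhoff_sum (\<lambda>z. f (z, w z + g)) n y / n - c\<bar> \<partial>\<nu>) \<le> 1"
        by (simp add: Y.prob_space)
    qed
  qed auto
  then show ?thesis
    using avg_err_coboundary[OF _ f_meas f] by (simp add: c_def)
qed

section \<open>The block construction of an equidistributing transfer function\<close>

lemma exists_equidistributing_transfer:
  assumes na: "nonatomic \<nu>" and \<phi>[measurable]: "\<phi> \<in> borel_measurable \<nu>"
    and f_meas[measurable]: "f \<in> borel_measurable P" and f: "\<And>p. 0 \<le> f p" "\<And>p. f p \<le> 1"
    and e: "0 < e"
  obtains w where "w \<in> borel_measurable \<nu>"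
    "measure \<nu> {y \<in> space \<nu>. w (T y) - w y \<noteq> \<phi> y} < e"
    "(\<integral>g. \<bar>(\<integral>z. f (z, w z + g) \<partial>\<nu>) - (\<integral>p. f p \<partial>P)\<bar> \<partial>L) < e"
proof -
  \<comment> \<open>The exceptional set will have measure at most \<open>2 / H\<close>, which
    \<open>2 / e\<close> puts below \<open>e\<close>. The second moment will be at most
    \<open>4 / H\<close>, which \<open>16 / e\<^sup>2\<close> puts below
    \<open>e\<^sup>2 / 4\<close>.\<close>
  obtain H :: nat where H: "max (16 / e\<^sup>2) (2 / e) < H"
    using reals_Archimedean2 by blast
  have H0: "0 < H"
  proof -
    have "0 < 2 / e" using e by simp
    then have "0 < real H" using H by linarith
    then show ?thesis by simp
  qed
  have He: "2 / H < e" "16 / H < e\<^sup>2"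
  proof -
    have "2 / e < H" "16 / e\<^sup>2 < H" "0 < e\<^sup>2" using H e by auto
    then show "2 / H < e" "16 / H < e\<^sup>2"
      using H0 e by (simp_all add: divide_less_eq mult.commute)
  qed
  \<comment> \<open>With this level-0 measure each residue modulo \<open>H * H\<close> has measure
    at most \<open>2 / (H * H)\<close>, so any \<open>H\<close> of them together stay within
    \<open>2 / H\<close>.\<close>
  define \<delta> where "\<delta> = 1 / (real H * real H)"
  have "0 < \<delta>" using H0 by (simp add: \<delta>_def)
  then obtain \<kappa> :: "'a \<Rightarrow> nat" where \<kappa>[measurable]: "\<kappa> \<in> measurable \<nu> (count_space UNIV)"
    and \<kappa>0: "measure \<nu> {y \<in> space \<nu>. \<kappa> y = 0} < \<delta>"
    and step: "\<And>y. 0 < \<kappa> y \<Longrightarrow> \<kappa> (T y) = \<kappa> y - 1"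
    using Y.exists_hitting_time[OF na] by metis
  have res: "measure \<nu> {y \<in> space \<nu>. \<kappa> y mod Q = j} \<le> 1 / Q + \<delta>" if "j < Q" for j Q
    using Y.hitting_time_residue[OF \<kappa> _ step that, of \<delta>] \<kappa>0 by simp
  \<comment> \<open>A block ends where \<open>\<kappa>\<close> is a multiple of \<open>H\<close>, so
    \<open>\<kappa> y div H\<close> numbers the blocks. Reducing modulo \<open>H\<close> groups them
    into \<open>H\<close> classes, each made of \<open>H\<close> residues of \<open>\<kappa>\<close>
    modulo \<open>H * H\<close>.\<close>
  define ix where "ix y = (\<kappa> y div H) mod H" for y
  have ix[measurable]: "ix \<in> measurable \<nu> (count_space UNIV)"
    unfolding ix_def by measurable
  have ixH: "ix y < H" for y
    using H0 by (simp add: ix_def)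
  define E where "E i = {y \<in> space \<nu>. ix y = i}" for i
  have E[measurable]: "E i \<in> sets \<nu>" for i
    unfolding E_def by measurable
  have Ebound: "measure \<nu> (E i) \<le> 2 / H" if "i < H" for i
  proof -
    have "E i \<subseteq> (\<Union>r<H. {y \<in> space \<nu>. \<kappa> y mod (H * H) = H * i + r})"
    proof
      fix y assume "y \<in> E i"
      then have "y \<in> space \<nu>" "\<kappa> y mod (H * H) = H * i + \<kappa> y mod H"
        by (auto simp: E_def ix_def mod_mult2_eq)
      then show "y \<in> (\<Union>r<H. {y \<in> space \<nu>. \<kappa> y mod (H * H) = H * i + r})"
        using H0 by auto
    qed
    then have "measure \<nu> (E i) \<le> measure \<nu> (\<Union>r<H. {y \<in> space \<nu>. \<kappa> y mod (H * H) = H * i + r})"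
      by (intro Y.finite_measure_mono) auto
    also have "\<dots> \<le> (\<Sum>r<H. measure \<nu> {y \<in> space \<nu>. \<kappa> y mod (H * H) = H * i + r})"
      by (intro measure_UNION_le) auto
    also have "\<dots> \<le> (\<Sum>r<H. 1 / real (H * H) + \<delta>)"
    proof (intro sum_mono res)
      fix r assume "r \<in> {..<H}"
      then have "H * i + r < H * Suc i" by simp
      also have "\<dots> \<le> H * H" using \<open>i < H\<close> by (intro mult_le_mono) auto
      finally show "H * i + r < H * H" .
    qed
    also have "\<dots> = 2 / H"
      using H0 by (simp add: \<delta>_def field_simps)
    finally show ?thesis .
  qed
  \<comment> \<open>Solves the coboundary equation backwards from the end of the block, where
    \<open>\<kappa> y mod H = 0\<close> and \<open>u\<close> vanishes.\<close>
  define u where "u y = - cocycle_sum T \<phi> (\<kappa> y mod H) y" for y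
  have u[measurable]: "u \<in> borel_measurable \<nu>"
  proof -
    have "(\<lambda>y. cocycle_sum T \<phi> (\<kappa> y mod H) y) \<in> borel_measurable \<nu>"
      by (rule measurable_compose_countable[where f = "\<lambda>k. cocycle_sum T \<phi> (k mod H)"])
        (auto intro: cocycle_sum_measurable)
    then show ?thesis unfolding u_def[abs_def] by measurable
  qed
  define m where "m z = (\<integral>h. f (z, h) \<partial>L)" for z
  have m_meas[measurable]: "m \<in> borel_measurable \<nu>"
    unfolding m_def[abs_def] by measurable
  have m01: "0 \<le> m z" "m z \<le> 1" for z
  proof -
    show "0 \<le> m z" unfolding m_def using f by simp
    have "m z \<le> (\<integral>h. 1 \<partial>L)"
      unfolding m_def using f by (intro integral_mono') auto
    then show "m z \<le> 1" by simp
  qed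
  \<comment> \<open>The contribution of class \<open>i\<close> to the deviation of the fibre
    integral from its mean, when \<open>x\<close> is the free element of that class.\<close>
  define D where "D i x g = (\<integral>z. indicator (E i) z * (f (z, u z + x + g) - m z) \<partial>\<nu>)" for i x g
  have b: "\<bar>indicator (E i) z * (f (z, k) - m z)\<bar> \<le> indicator (E i) z" for i z k
    using f[of "(z, k)"] m01[of z] by (auto simp: indicator_def)
  have b1: "\<bar>indicator (E i) z * (f (z, k) - m z)\<bar> \<le> 1" for i z k
    using b[of i z k] by (auto simp: indicator_def split: if_splits)
  have inner_meas: "(\<lambda>(p, z). indicator (E i) z * (f (z, u z + fst p + snd p) - m z))
      \<in> borel_measurable ((L \<Otimes>\<^sub>M L) \<Otimes>\<^sub>M \<nu>)" for i
    by measurable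
  have int: "integrable \<nu> (\<lambda>z. indicator (E i) z * (f (z, u z + x + g) - m z))" for i x g
    by (intro Y.integrable_const_bound[where B = 1] AE_I2) (use b1 in auto)
  obtain x where x: "(\<integral>g. (\<Sum>i<H. D i (x i) g)\<^sup>2 \<partial>L) \<le> (\<Sum>i<H. (measure \<nu> (E i))\<^sup>2)"
  proof -
    have "\<exists>x. (\<forall>i. x i \<in> space L) \<and> (\<integral>g. (\<Sum>i<H. D i (x i) g)\<^sup>2 \<partial>L) \<le> (\<Sum>i<H. (measure \<nu> (E i))\<^sup>2)"
    proof (rule G.exists_small_second_moment)
      fix i
      show "(\<lambda>(x, g). D i x g) \<in> borel_measurable (L \<Otimes>\<^sub>M L)"
        using Y.borel_measurable_lebesgue_integral[OF inner_meas[of i]] by (simp add: D_def split_beta')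
      fix g
      have "integrable \<nu> (indicat_real (E i))"
        by (intro integrable_real_indicator) (auto simp: Y.emeasure_eq_measure)
      then have "\<bar>D i x g\<bar> \<le> (\<integral>z. indicator (E i) z \<partial>\<nu>)" for x
        unfolding D_def using b
        by (intro order.trans[OF integral_abs_bound] integral_mono integrable_abs int) auto
      then show "\<bar>D i x g\<bar> \<le> measure \<nu> (E i)" for x
        by simp
      interpret Q: pair_prob_space L \<nu> ..
      have "integrable (L \<Otimes>\<^sub>M \<nu>) (\<lambda>(x, z). indicator (E i) z * (f (z, u z + x + g) - m z))"
        by (intro Q.P.integrable_const_bound[where B = 1] AE_I2) (use b1 in auto)
      from Q.Fubini_integral[OF this]
      have "(\<integral>x. D i x g \<partial>L) = (\<integral>z. (\<integral>x. indicator (E i) z * (f (z, u z + x + g) - m z) \<partial>L) \<partial>\<nu>)"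
        by (simp add: D_def)
      also have "\<dots> = (\<integral>z. 0 \<partial>\<nu>)"
      proof (rule Bochner_Integration.integral_cong[OF refl])
        fix z assume z: "z \<in> space \<nu>"
        have fz: "(\<lambda>h. f (z, h)) \<in> borel_measurable borel"
          using measurable_compose[OF measurable_Pair1'[OF z] f_meas]
          by (simp add: measurable_cong_sets[OF G.sets_L refl])
        have fb: "\<bar>f p\<bar> \<le> 1" for p using f[of p] by auto
        note [measurable] = fz
        \<comment> \<open>The variable \<open>x\<close> stands between \<open>u z\<close> and
          \<open>g\<close>, so right invariance removes \<open>g\<close> and left invariance removes
          \<open>u z\<close>.\<close>
        have "(\<integral>x. f (z, u z + x + g) \<partial>L) = (\<integral>x. f (z, u z + x) \<partial>L)"
          using G.integral_right[of "\<lambda>x. f (z, u z + x)" 1 g] fb by (simp add: add.assoc)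
        also have "\<dots> = m z"
          unfolding m_def by (rule G.integral_left[OF fz])
        finally have "(\<integral>x. f (z, u z + x + g) - m z \<partial>L) = 0"
          using G.integrable_bounded[of "\<lambda>x. f (z, u z + x + g)" 1] fb by simp
        then show "(\<integral>x. indicator (E i) z * (f (z, u z + x + g) - m z) \<partial>L) = 0"
          by simp
      qed
      finally show "(\<integral>x. D i x g \<partial>L) = 0" by simp
    qed
    then show ?thesis using that by blast
  qed
  define w where "w y = u y + x (ix y)" for y
  have w[measurable]: "w \<in> borel_measurable \<nu>"
    unfolding w_def[abs_def] by measurable
  \<comment> \<open>Before the end of a block, one step lowers \<open>\<kappa>\<close> without
    changing its block number. So \<open>ix\<close> is constant and the element added on the right
    of \<open>u\<close> cancels in the difference.\<close>
  have good: "w (T y) - w y = \<phi> y" if "\<kappa> y mod H \<noteq> 0" for y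
  proof -
    from that obtain r where r: "\<kappa> y mod H = Suc r"
      using not0_implies_Suc by blast
    have pos: "0 < \<kappa> y" using that by (cases "\<kappa> y") auto
    obtain n where n: "\<kappa> y = Suc n" using pos gr0_conv_Suc by blast
    have "n mod H = r" using r by (auto simp: n mod_Suc split: if_splits)
    moreover have "n div H = Suc n div H"
      using that by (simp add: n div_Suc)
    ultimately have "\<kappa> (T y) mod H = r" "ix (T y) = ix y"
      using step[OF pos] by (simp_all add: n ix_def)
    then show ?thesis
      by (simp add: w_def u_def r diff_add_eq_diff_diff_swap)
  qed
  have "measure \<nu> {y \<in> space \<nu>. w (T y) - w y \<noteq> \<phi> y} \<le> measure \<nu> {y \<in> space \<nu>. \<kappa> y mod H = 0}"
    using good by (intro Y.finite_measure_mono) auto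
  also have "\<dots> \<le> 1 / H + \<delta>" using res[OF H0] .
  also have "\<dots> \<le> 2 / H" using H0 by (simp add: \<delta>_def field_simps)
  finally have 1: "measure \<nu> {y \<in> space \<nu>. w (T y) - w y \<noteq> \<phi> y} < e"
    using He by simp
  define c where "c = (\<integral>p. f p \<partial>P)"
  have "integrable P f"
    by (intro P.P.integrable_const_bound[where B = 1]) (use f in auto)
  then have c: "c = (\<integral>z. m z \<partial>\<nu>)"
    unfolding c_def m_def by (rule P.integral_fst'[symmetric])
  \<comment> \<open>The classes partition the base, so at each \<open>z\<close> only the summand
    with index \<open>ix z\<close> survives.\<close>
  have S: "(\<Sum>i<H. D i (x i) g) = (\<integral>z. f (z, w z + g) \<partial>\<nu>) - c" for g
  proof -
    have "(\<Sum>i<H. D i (x i) g) = (\<integral>z. (\<Sum>i<H. indicator (E i) z * (f (z, u z + x i + g) - m z)) \<partial>\<nu>)"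
      unfolding D_def by (rule Bochner_Integration.integral_sum[symmetric]) (rule int)
    also have "\<dots> = (\<integral>z. f (z, w z + g) - m z \<partial>\<nu>)"
    proof (rule Bochner_Integration.integral_cong[OF refl])
      fix z assume z: "z \<in> space \<nu>"
      have "(\<Sum>i<H. indicator (E i) z * (f (z, u z + x i + g) - m z)) =
          (\<Sum>i<H. if i = ix z then f (z, u z + x i + g) - m z else 0)"
        using z by (intro sum.cong) (auto simp: E_def indicator_def)
      then show "(\<Sum>i<H. indicator (E i) z * (f (z, u z + x i + g) - m z)) = f (z, w z + g) - m z"
        using ixH[of z] by (simp add: w_def)
    qed
    also have "\<dots> = (\<integral>z. f (z, w z + g) \<partial>\<nu>) - (\<integral>z. m z \<partial>\<nu>)"
      by (intro Bochner_Integration.integral_diff Y.integrable_const_bound[where B = 1])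
        (use f m01 in auto)
    finally show ?thesis by (simp add: c)
  qed
  define s where "s g = (\<integral>z. f (z, w z + g) \<partial>\<nu>) - c" for g
  have s_meas[measurable]: "s \<in> borel_measurable L"
    unfolding s_def[abs_def] by measurable
  have c01: "0 \<le> c" "c \<le> 1"
    unfolding c_def using integral_bounds[OF f_meas f] by auto
  have s1: "\<bar>s g\<bar> \<le> 1" for g
  proof -
    have "0 \<le> (\<integral>z. f (z, w z + g) \<partial>\<nu>)" using f by simp
    moreover have "(\<integral>z. f (z, w z + g) \<partial>\<nu>) \<le> (\<integral>z. 1 \<partial>\<nu>)"
      using f by (intro integral_mono') auto
    ultimately show ?thesis
      using c01 by (simp add: s_def Y.prob_space abs_le_iff)
  qed
  have s2: "integrable L (\<lambda>g. (s g)\<^sup>2)" "integrable L (\<lambda>g. \<bar>s g\<bar>)"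
    using s1 by (auto intro!: G.integrable_const_bound[where B = 1] simp: abs_square_le_1)
  have "(\<integral>g. (s g)\<^sup>2 \<partial>L) \<le> (\<Sum>i<H. (measure \<nu> (E i))\<^sup>2)"
    using x by (simp add: S s_def)
  also have "\<dots> \<le> (\<Sum>i<H. (2 / H)\<^sup>2)"
    by (intro sum_mono power_mono Ebound) auto
  also have "\<dots> = 4 / H"
    using H0 by (simp add: power2_eq_square)
  also have "\<dots> < e\<^sup>2 / 4"
    using He by simp
  finally have sq: "(\<integral>g. (s g)\<^sup>2 \<partial>L) < e\<^sup>2 / 4" .
  \<comment> \<open>Completing the square at \<open>e / 2\<close> trades the first moment for the
    second: a second moment below \<open>e\<^sup>2 / 4\<close> leaves less than
    \<open>e / 4 + e / 4\<close>.\<close>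
  have pt: "\<bar>t\<bar> \<le> e / 4 + t\<^sup>2 / e" for t :: real
  proof -
    have "0 \<le> (\<bar>t\<bar> - e / 2)\<^sup>2" by simp
    then have "e * \<bar>t\<bar> \<le> e * (e / 4) + t\<^sup>2"
      by (simp add: power2_diff power2_eq_square algebra_simps)
    then show ?thesis using e by (simp add: field_simps)
  qed
  have "(\<integral>g. \<bar>s g\<bar> \<partial>L) \<le> (\<integral>g. e / 4 + (s g)\<^sup>2 / e \<partial>L)"
    using pt s2 by (intro integral_mono) auto
  also have "\<dots> = e / 4 + (\<integral>g. (s g)\<^sup>2 \<partial>L) / e"
    using s2 by simp
  also have "\<dots> < e / 4 + (e\<^sup>2 / 4) / e"
    by (intro add_strict_left_mono divide_strict_right_mono sq e)
  also have "\<dots> < e"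
    using e by (simp add: power2_eq_square)
  finally have "(\<integral>g. \<bar>(\<integral>z. f (z, w z + g) \<partial>\<nu>) - (\<integral>p. f p \<partial>P)\<bar> \<partial>L) < e"
    by (simp add: s_def c_def)
  from w 1 this show thesis by (rule that)
qed

text \<open>The coboundary of the equidistributing \<open>w\<close> serves: its errors converge to a
  limit below \<open>e\<close>, so some finite \<open>n\<close> already works.\<close>

lemma exists_close_averaging_cocycle:
  assumes "nonatomic \<nu>" and \<phi>: "\<phi> \<in> borel_measurable \<nu>"
    and f: "f \<in> borel_measurable P" "\<And>p. 0 \<le> f p" "\<And>p. f p \<le> 1"
    and "0 < e"
  obtains \<psi> n where "\<psi> \<in> borel_measurable \<nu>" "measure \<nu> {y \<in> space \<nu>. \<psi> y \<noteq> \<phi> y} < e"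
    "0 < n" "avg_err \<psi> n f < e"
proof -
  obtain w where w[measurable]: "w \<in> borel_measurable \<nu>"
    and 1: "measure \<nu> {y \<in> space \<nu>. w (T y) - w y \<noteq> \<phi> y} < e"
    and 2: "(\<integral>g. \<bar>(\<integral>z. f (z, w z + g) \<partial>\<nu>) - (\<integral>p. f p \<partial>P)\<bar> \<partial>L) < e"
    using exists_equidistributing_transfer[OF assms] .
  have "\<forall>\<^sub>F n in sequentially. avg_err (\<lambda>y. w (T y) - w y) n f < e"
    using order_tendstoD(2)[OF avg_err_coboundary_tendsto[OF w f] 2] .
  then have "\<forall>\<^sub>F n in sequentially. 0 < n \<and> avg_err (\<lambda>y. w (T y) - w y) n f < e"
    using eventually_gt_at_top by (rule eventually_conj[rotated])
  then obtain n where "0 < n" "avg_err (\<lambda>y. w (T y) - w y) n f < e"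
    using eventually_happens'[OF sequentially_bot] by blast
  moreover have "(\<lambda>y. w (T y) - w y) \<in> borel_measurable \<nu>" by measurable
  ultimately show thesis using 1 that by blast
qed

end

section \<open>The space of cocycles\<close>

locale compact_group_metric =
  fixes d :: "'g::{topological_group_add, second_countable_topology} \<Rightarrow> 'g \<Rightarrow> real"
  assumes Metric: "Metric_space UNIV d"
    and mtop: "Metric_space.mtopology UNIV d = euclidean"
    and left_iso: "d (a + x) (a + y) = d x y"
    and right_iso: "d (x + a) (y + a) = d x y"
    and compact_UNIV: "compact (UNIV :: 'g set)"
begin

sublocale D: Metric_space UNIV d
  by (rule Metric)

lemma compact_space_mtopology: "compact_space D.mtopology"
  by (simp add: mtop compact_space_def compact_UNIV)

lemma D_complete: "D.mcomplete"
  by (rule D.compact_space_imp_mcomplete[OF compact_space_mtopology])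

text \<open>Some positive bound rather than the exact diameter, so that it is positive even for the
  one-point group.\<close>

definition diam :: real where
  "diam = (SOME K. 0 < K \<and> (\<forall>x y. d x y \<le> K))"

lemma diam_pos: "0 < diam" and d_le_diam: "d x y \<le> diam"
proof -
  have "D.mbounded UNIV"
    using D.compactin_imp_mbounded[of UNIV] by (simp add: mtop compact_UNIV)
  then obtain c B where B: "\<And>x. d c x \<le> B"
    unfolding D.mbounded_def subset_iff D.in_mcball by auto
  have "d x y \<le> 2 * B + 1" for x y
    using D.triangle[of x c y] B[of x] B[of y] D.commute[of x c] by auto
  moreover have "0 < 2 * B + 1"
    using B[of c] by simp
  ultimately have "\<exists>K. 0 < K \<and> (\<forall>x y. d x y \<le> K)" by blast
  from someI_ex[OF this] show "0 < diam" "d x y \<le> diam"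
    unfolding diam_def by auto
qed

lemma d_add_le: "d (a + b) (a' + b') \<le> d a a' + d b b'"
  using D.triangle[of "a + b" "a' + b" "a' + b'"] by (simp add: left_iso right_iso)

text \<open>Bi-invariance makes addition nonexpanding in both arguments together
  (\<open>d_add_le\<close>), so the errors made along the orbit simply add up.\<close>

lemma cocycle_sum_dist_le:
  "d (cocycle_sum T \<phi> k y) (cocycle_sum T \<psi> k y) \<le>
    (\<Sum>j<k. d (\<phi> ((T ^^ j) y)) (\<psi> ((T ^^ j) y)))"
proof (induction k arbitrary: y)
  case (Suc k)
  have "d (cocycle_sum T \<phi> (Suc k) y) (cocycle_sum T \<psi> (Suc k) y) \<le>
      d (cocycle_sum T \<phi> k (T y)) (cocycle_sum T \<psi> k (T y)) + d (\<phi> y) (\<psi> y)"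
    using d_add_le by simp
  also have "\<dots> \<le> (\<Sum>j<k. d (\<phi> ((T ^^ j) (T y))) (\<psi> ((T ^^ j) (T y)))) + d (\<phi> y) (\<psi> y)"
    using Suc[of "T y"] by simp
  also have "\<dots> = (\<Sum>j<Suc k. d (\<phi> ((T ^^ j) y)) (\<psi> ((T ^^ j) y)))"
    by (simp add: sum.lessThan_Suc_shift funpow_swap1 del: sum.lessThan_Suc)
  finally show ?case .
qed simp

lemma lipschitz_continuous:
  fixes F :: "'g \<Rightarrow> real"
  assumes "\<And>g h. \<bar>F g - F h\<bar> \<le> K * d g h"
  shows "continuous_on UNIV F"
  unfolding continuous_on_def
proof (intro ballI tendstoI)
  fix g :: 'g and e :: real
  assume "0 < e"
  \<comment> \<open>The added 1 keeps the denominator positive when \<open>K = 0\<close>.\<close>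
  define r where "r = e / (\<bar>K\<bar> + 1)"
  have "0 < r" using \<open>0 < e\<close> by (simp add: r_def)
  have "open (D.mball g r)"
    using D.openin_mball[of g r] by (simp add: mtop)
  moreover have "g \<in> D.mball g r" using \<open>0 < r\<close> by simp
  moreover have "dist (F h) (F g) < e" if "h \<in> D.mball g r" for h
  proof -
    have h: "d h g < r" using that by (simp add: D.commute)
    have "\<bar>F h - F g\<bar> \<le> K * d h g" by (rule assms)
    also have "\<dots> \<le> (\<bar>K\<bar> + 1) * d h g"
      by (intro mult_right_mono) auto
    also have "\<dots> < (\<bar>K\<bar> + 1) * r"
      using h by (intro mult_strict_left_mono) auto
    also have "\<dots> = e" by (simp add: r_def)
    finally show ?thesis by (simp add: dist_real_def)
  qed
  ultimately show "\<forall>\<^sub>F h in at g. dist (F h) (F g) < e"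
    unfolding eventually_at_topological by blast
qed

text \<open>The value \<open>1\<close> for the whole space replaces the infimum over the empty set.\<close>

definition dist_compl :: "'g set \<Rightarrow> 'g \<Rightarrow> real" where
  "dist_compl U g = (if U = UNIV then 1 else INF x\<in>-U. d g x)"

lemma dist_compl_nonneg: "0 \<le> dist_compl U g"
  by (auto simp: dist_compl_def intro!: cINF_greatest)

lemma dist_compl_lipschitz: "\<bar>dist_compl U g - dist_compl U h\<bar> \<le> d g h"
proof (cases "U = UNIV")
  case False
  have bdd: "bdd_below (d g ` (- U))" for g
    by (rule bdd_belowI[of _ 0]) auto
  have *: "(INF x\<in>-U. d g x) - d g h \<le> (INF x\<in>-U. d h x)" for g h
  proof (rule cINF_greatest)
    show "- U \<noteq> {}" using False by auto
    fix x assume "x \<in> - U"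
    then have "(INF x\<in>-U. d g x) \<le> d g x"
      by (intro cINF_lower bdd)
    then show "(INF x\<in>-U. d g x) - d g h \<le> d h x"
      using D.triangle[of g h x] by simp
  qed
  show ?thesis
    using *[of g h] *[of h g] False by (simp add: dist_compl_def D.commute)
qed (simp add: dist_compl_def)

lemma dist_compl_pos_iff:
  assumes "open U"
  shows "0 < dist_compl U g \<longleftrightarrow> g \<in> U"
proof (cases "U = UNIV")
  case False
  have bdd: "bdd_below (d g ` (- U))"
    by (rule bdd_belowI[of _ 0]) auto
  show ?thesis
  proof
    assume pos: "0 < dist_compl U g"
    show "g \<in> U"
    proof (rule ccontr)
      assume "g \<notin> U"
      then have "(INF x\<in>-U. d g x) \<le> d g g"
        by (intro cINF_lower bdd) auto
      with pos False show False by (simp add: dist_compl_def)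
    qed
  next
    assume "g \<in> U"
    then obtain r where r: "0 < r" "D.mball g r \<subseteq> U"
      using assms mtop D.openin_mtopology[of U] by auto
    have "r \<le> (INF x\<in>-U. d g x)"
      using False r(2) by (intro cINF_greatest) (auto simp: not_less[symmetric])
    then show "0 < dist_compl U g"
      using r(1) False by (simp add: dist_compl_def)
  qed
qed (simp add: dist_compl_def)

lemma dist_compl_continuous: "continuous_on UNIV (dist_compl U)"
  by (rule lipschitz_continuous[where K = 1]) (use dist_compl_lipschitz in simp)

lemma dist_compl_measurable [measurable]: "dist_compl U \<in> borel_measurable borel"
  by (rule borel_measurable_continuous_onI[OF dist_compl_continuous])

lemma d_measurable [measurable (raw)]:
  "f \<in> borel_measurable M \<Longrightarrow> g \<in> borel_measurable M \<Longrightarrow> (\<lambda>y. d (f y) (g y)) \<in> borel_measurable M"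
  by (rule metric_measurable[OF Metric mtop])

text \<open>An open \<open>U\<close> is the positivity set of the Lipschitz function
  \<open>dist_compl U\<close>, and \<open>dist_compl U (\<phi> y)\<close> is a pointwise limit of
  measurable real functions.\<close>

lemma lim_measurable:
  assumes \<psi>: "\<And>k. \<psi> k \<in> borel_measurable M"
    and lim: "\<And>y. y \<in> space M \<Longrightarrow> (\<lambda>k. d (\<psi> k y) (\<phi> y)) \<longlonglongrightarrow> 0"
  shows "\<phi> \<in> borel_measurable M"
proof (rule borel_measurableI)
  fix U :: "'g set" assume U: "open U"
  have "(\<lambda>y. dist_compl U (\<phi> y)) \<in> borel_measurable M"
  proof (rule borel_measurable_LIMSEQ_real)
    show "(\<lambda>k. dist_compl U (\<psi> k y)) \<longlonglongrightarrow> dist_compl U (\<phi> y)" if "y \<in> space M" for y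
      using dist_compl_lipschitz
      by (intro LIM_zero_cancel[OF Lim_null_comparison[OF _ lim[OF that]]]) auto
    show "(\<lambda>y. dist_compl U (\<psi> k y)) \<in> borel_measurable M" for k
      by (rule measurable_compose[OF \<psi> dist_compl_measurable])
  qed
  then have "{y \<in> space M. 0 < dist_compl U (\<phi> y)} \<in> sets M"
    by measurable
  then show "\<phi> -` U \<inter> space M \<in> sets M"
    by (simp add: dist_compl_pos_iff[OF U] vimage_def Int_def conj_commute)
qed

end

section \<open>Comparison of two distances between cocycles, and completeness\<close>

locale cocycle_space = Y: prob_space \<nu> + compact_group_metric d
  for \<nu> :: "'a measure"
    and d :: "'g::{topological_group_add, second_countable_topology} \<Rightarrow> 'g \<Rightarrow> real"
begin

sublocale C: Metric_space "cocycles \<nu>" "cocycle_dist \<nu> d"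
  by (rule Metric_space_cocycles[OF Y.prob_space_axioms Metric mtop])

text \<open>An integral is easier to follow along orbits than the infimum in
  \<open>map_dist\<close>. As \<open>d\<close> is bounded, the two distances are uniformly
  equivalent, which the next lemmas make quantitative.\<close>

definition mean_dist :: "('a \<Rightarrow> 'g) \<Rightarrow> ('a \<Rightarrow> 'g) \<Rightarrow> real" where
  "mean_dist \<phi> \<psi> = (\<integral>y. d (\<phi> y) (\<psi> y) \<partial>\<nu>)"

lemma integrable_d:
  assumes [measurable]: "\<phi> \<in> borel_measurable \<nu>" "\<psi> \<in> borel_measurable \<nu>"
  shows "integrable \<nu> (\<lambda>y. d (\<phi> y) (\<psi> y))"
  by (intro Y.integrable_const_bound[where B = diam]) (auto simp: d_le_diam)

lemma far_measurable [measurable (raw)]: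
  assumes "\<phi> \<in> borel_measurable \<nu>" "\<psi> \<in> borel_measurable \<nu>"
  shows "{y \<in> space \<nu>. d (\<phi> y) (\<psi> y) > e} \<in> sets \<nu>"
  by (rule far_sets[OF Y.prob_space_axioms Metric mtop assms])

text \<open>The condition on \<open>e\<close> in the infimum is preserved when \<open>e\<close>
  grows, so it holds everywhere above the infimum.\<close>

lemma far_le_map_dist:
  assumes [measurable]: "\<phi> \<in> borel_measurable \<nu>" "\<psi> \<in> borel_measurable \<nu>" and "map_dist \<nu> d \<phi> \<psi> < e"
  shows "measure \<nu> {y \<in> space \<nu>. d (\<phi> y) (\<psi> y) > e} < e"
proof -
  obtain r where r: "measure \<nu> {y \<in> space \<nu>. d (\<phi> y) (\<psi> y) > r} < r" "r < e"
    using cInf_lessD[OF map_dist_ne[OF Y.prob_space_axioms Metric mtop], of \<phi> \<psi> e] assms(3)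
    unfolding map_dist_def by auto
  have "measure \<nu> {y \<in> space \<nu>. d (\<phi> y) (\<psi> y) > e} \<le> measure \<nu> {y \<in> space \<nu>. d (\<phi> y) (\<psi> y) > r}"
    using r by (intro Y.finite_measure_mono) auto
  then show ?thesis using r by linarith
qed

lemma map_dist_le:
  assumes "measure \<nu> {y \<in> space \<nu>. d (\<phi> y) (\<psi> y) > e} < e"
  shows "map_dist \<nu> d \<phi> \<psi> \<le> e"
  unfolding map_dist_def
  using assms map_dist_bdd[OF Y.prob_space_axioms Metric mtop] by (intro cInf_lower) auto

text \<open>The integrand is at most \<open>e\<close> off the far set and at most
  \<open>diam\<close> on it, and the far set has measure below \<open>e\<close>.\<close>

lemma mean_dist_le:
  assumes [measurable]: "\<phi> \<in> borel_measurable \<nu>" "\<psi> \<in> borel_measurable \<nu>"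
    and "map_dist \<nu> d \<phi> \<psi> < e"
  shows "mean_dist \<phi> \<psi> \<le> (1 + diam) * e"
proof -
  let ?F = "{y \<in> space \<nu>. d (\<phi> y) (\<psi> y) > e}"
  have far: "measure \<nu> ?F < e" by (rule far_le_map_dist) fact+
  have int: "integrable \<nu> (indicat_real ?F)"
    by (intro integrable_real_indicator) (auto simp: Y.emeasure_eq_measure)
  have "0 < e" using far measure_nonneg[of \<nu> ?F] by linarith
  have "mean_dist \<phi> \<psi> \<le> (\<integral>y. e + diam * indicator ?F y \<partial>\<nu>)"
    unfolding mean_dist_def
  proof (rule integral_mono)
    fix y assume "y \<in> space \<nu>"
    then show "d (\<phi> y) (\<psi> y) \<le> e + diam * indicator ?F y"
      using d_le_diam[of "\<phi> y" "\<psi> y"] \<open>0 < e\<close> by (auto simp: indicator_def)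
  qed (use int in \<open>auto intro!: integrable_d\<close>)
  also have "\<dots> = e + diam * measure \<nu> ?F"
    using int by (simp add: Y.prob_space)
  also have "\<dots> \<le> e + diam * e"
    using far diam_pos by simp
  finally show ?thesis by (simp add: algebra_simps)
qed

text \<open>Markov's inequality at level \<open>e\<close>: one factor of the square is the level,
  the other the resulting bound on the measure.\<close>

lemma map_dist_le_of_mean_dist:
  assumes [measurable]: "\<phi> \<in> borel_measurable \<nu>" "\<psi> \<in> borel_measurable \<nu>"
    and "mean_dist \<phi> \<psi> < e\<^sup>2" and "0 < e"
  shows "map_dist \<nu> d \<phi> \<psi> \<le> e"
proof (rule map_dist_le)
  have "measure \<nu> {y \<in> space \<nu>. d (\<phi> y) (\<psi> y) > e} \<le> measure \<nu> {y \<in> space \<nu>. d (\<phi> y) (\<psi> y) \<ge> e}"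
    by (intro Y.finite_measure_mono) auto
  also have "\<dots> \<le> mean_dist \<phi> \<psi> / e"
    unfolding mean_dist_def using \<open>0 < e\<close>
    by (intro integral_Markov_inequality_measure[OF integrable_d, where A = "space \<nu>"]) auto
  also have "\<dots> < e"
    using assms(3,4) by (simp add: divide_less_eq power2_eq_square)
  finally show "measure \<nu> {y \<in> space \<nu>. d (\<phi> y) (\<psi> y) > e} < e" .
qed

definition cls :: "('a \<Rightarrow> 'g) \<Rightarrow> ('a \<Rightarrow> 'g) set" where
  "cls \<phi> = ae_eq_rel \<nu> `` {\<phi>}"

lemma cls: assumes "\<phi> \<in> borel_measurable \<nu>" shows "cls \<phi> \<in> cocycles \<nu>" "\<phi> \<in> cls \<phi>"
proof -
  show "cls \<phi> \<in> cocycles \<nu>"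
    unfolding cls_def cocycles_def using assms by (rule quotientI)
  show "\<phi> \<in> cls \<phi>"
    using assms by (simp add: cls_def ae_eq_rel_def)
qed

lemma cocycleD:
  assumes "c \<in> cocycles \<nu>"
  shows "\<phi> \<in> c \<Longrightarrow> \<phi> \<in> borel_measurable \<nu>"
    and "\<phi> \<in> c \<Longrightarrow> \<psi> \<in> c \<Longrightarrow> AE y in \<nu>. \<phi> y = \<psi> y"
    and "\<exists>\<phi>. \<phi> \<in> c"
proof -
  show "\<phi> \<in> c \<Longrightarrow> \<phi> \<in> borel_measurable \<nu>"
    using assms unfolding cocycles_def by (auto simp: quotient_def ae_eq_rel_def)
  show "AE y in \<nu>. \<phi> y = \<psi> y" if "\<phi> \<in> c" "\<psi> \<in> c"
    using in_quotient_imp_in_rel[OF equiv_ae_eq_rel, of c \<nu> \<phi> \<psi>] assms that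
    by (auto simp: cocycles_def ae_eq_rel_def)
  show "\<exists>\<phi>. \<phi> \<in> c"
    using some_cocycle(1)[OF Y.prob_space_axioms Metric mtop assms] by blast
qed

lemmas dist_eq = cocycle_dist_eq[OF Y.prob_space_axioms Metric mtop]

text \<open>The Riesz argument: a rapidly converging subsequence is pointwise Cauchy almost
  everywhere by Borel-Cantelli, the complete metric \<open>d\<close> supplies a limit, and dominated
  convergence turns pointwise into metric convergence. A Cauchy sequence with a convergent
  subsequence converges.\<close>

lemma C_complete: "C.mcomplete"
  unfolding C.mcomplete_def
proof (intro allI impI)
  fix \<sigma> assume \<sigma>: "C.MCauchy \<sigma>"
  then have \<sigma>C: "\<sigma> n \<in> cocycles \<nu>" for n
    by (auto simp: C.MCauchy_def)
  have "\<exists>N. \<forall>m n. N \<le> m \<longrightarrow> N \<le> n \<longrightarrow> cocycle_dist \<nu> d (\<sigma> m) (\<sigma> n) < (1/2) ^ k" for k :: nat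
    using \<sigma> unfolding C.MCauchy_def by simp
  then obtain N where N: "\<And>k m n. N k \<le> m \<Longrightarrow> N k \<le> n \<Longrightarrow> cocycle_dist \<nu> d (\<sigma> m) (\<sigma> n) < (1/2) ^ k"
    by metis
  \<comment> \<open>The sum gives \<open>N k \<le> r k\<close>; the added \<open>k\<close> makes
    \<open>r\<close> strictly increasing.\<close>
  define r where "r k = (\<Sum>j\<le>k. N j) + k" for k
  have r: "strict_mono r"
    by (rule strict_monoI_Suc) (simp add: r_def)
  have rN: "N k \<le> r k" for k
    using member_le_sum[of k "{..k}" N] by (simp add: r_def)
  define \<psi> where "\<psi> k = (SOME \<phi>. \<phi> \<in> \<sigma> (r k))" for k
  have \<psi>: "\<psi> k \<in> \<sigma> (r k)" for k
    unfolding \<psi>_def by (rule someI_ex[OF cocycleD(3)[OF \<sigma>C]])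
  have \<psi>m[measurable]: "\<psi> k \<in> borel_measurable \<nu>" for k
    using cocycleD(1)[OF \<sigma>C \<psi>] .
  define A where "A k = {y \<in> space \<nu>. d (\<psi> k y) (\<psi> (Suc k) y) > (1/2) ^ k}" for k
  have A[measurable]: "A k \<in> sets \<nu>" for k
    unfolding A_def by measurable
  have "map_dist \<nu> d (\<psi> k) (\<psi> (Suc k)) < (1/2) ^ k" for k
  proof -
    have "N k \<le> r (Suc k)" using rN[of k] strict_mono_less[OF r, of k "Suc k"] by simp
    then show ?thesis
      using N[OF rN[of k], of "r (Suc k)"] dist_eq[OF \<sigma>C \<sigma>C \<psi> \<psi>, of k "Suc k"] by simp
  qed
  then have Ak: "measure \<nu> (A k) < (1/2) ^ k" for k
    unfolding A_def by (intro far_le_map_dist) auto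
  have "AE y in \<nu>. \<forall>\<^sub>F k in sequentially. y \<in> space \<nu> - A k"
  proof (rule borel_cantelli_AE1)
    show "summable (\<lambda>k. measure \<nu> (A k))"
      using Ak by (intro summable_comparison_test'[OF summable_geometric[of "1/2"]]) (auto intro: less_imp_le)
  qed (auto simp: Y.emeasure_eq_measure)
  then have good: "AE y in \<nu>. \<exists>K. \<forall>k\<ge>K. y \<notin> A k"
    by eventually_elim (auto simp: eventually_sequentially)
  have conv: "\<exists>l. (\<lambda>k. d (\<psi> k y) l) \<longlonglongrightarrow> 0" if K: "\<forall>k\<ge>K. y \<notin> A k" and y: "y \<in> space \<nu>" for y K
  proof -
    have step: "d (\<psi> k y) (\<psi> (Suc k) y) \<le> (1/2) ^ k" if "K \<le> k" for k
      using K that y by (auto simp: A_def not_less)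
    \<comment> \<open>The bound is the exact geometric sum of the steps from \<open>k\<close> to
      \<open>k + m\<close>, which lets the induction close.\<close>
    have far: "d (\<psi> k y) (\<psi> (k + m) y) \<le> 2 * (1/2) ^ k - 2 * (1/2) ^ (k + m)" if "K \<le> k" for k m
    proof (induction m)
      case (Suc m)
      have "d (\<psi> k y) (\<psi> (k + Suc m) y) \<le> d (\<psi> k y) (\<psi> (k + m) y) + d (\<psi> (k + m) y) (\<psi> (Suc (k + m)) y)"
        using D.triangle by simp
      moreover have "d (\<psi> (k + m) y) (\<psi> (Suc (k + m)) y) \<le> (1/2) ^ (k + m)"
        by (rule step) (use that in simp)
      moreover have "(1/2::real) ^ (k + Suc m) = (1/2) ^ (k + m) / 2"
        by simp
      ultimately show ?case using Suc by linarith
    qed simp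
    have "D.MCauchy (\<lambda>k. \<psi> k y)"
      unfolding D.MCauchy_def
    proof (intro conjI allI impI)
      fix e :: real assume "0 < e"
      then obtain n where n: "(1/2) ^ n < e / 4"
        using real_arch_pow_inv[of "e / 4" "1/2"] by auto
      let ?N = "max K n"
      have small: "(1/2) ^ ?N < e / 4"
        by (rule le_less_trans[OF power_decreasing n]) auto
      have near: "d (\<psi> ?N y) (\<psi> m y) < e / 2" if "?N \<le> m" for m
      proof -
        have "d (\<psi> ?N y) (\<psi> (?N + (m - ?N)) y) \<le> 2 * (1/2) ^ ?N - 2 * (1/2) ^ (?N + (m - ?N))"
          by (rule far) simp
        moreover have "0 < (1/2::real) ^ (?N + (m - ?N))" by simp
        ultimately have "d (\<psi> ?N y) (\<psi> (?N + (m - ?N)) y) < e / 2"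
          using small by linarith
        then show ?thesis using that by simp
      qed
      have "d (\<psi> m y) (\<psi> m' y) < e" if "?N \<le> m" "?N \<le> m'" for m m'
        using near[OF that(1)] near[OF that(2)] D.triangle[of "\<psi> m y" "\<psi> ?N y" "\<psi> m' y"]
          D.commute[of "\<psi> m y" "\<psi> ?N y"] by auto
      then show "\<exists>N. \<forall>m m'. N \<le> m \<longrightarrow> N \<le> m' \<longrightarrow> d (\<psi> m y) (\<psi> m' y) < e"
        by blast
    qed simp
    then obtain l where "limitin D.mtopology (\<lambda>k. \<psi> k y) l sequentially"
      using D_complete unfolding D.mcomplete_def by blast
    then have "\<forall>e>0. \<forall>\<^sub>F k in sequentially. d (\<psi> k y) l < e"
      by (simp add: D.limitin_metric)
    then have "(\<lambda>k. d (\<psi> k y) l) \<longlonglongrightarrow> 0"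
      by (intro tendstoI) (simp add: dist_real_def)
    then show ?thesis by blast
  qed
  define S where "S = {y \<in> space \<nu>. \<exists>K. \<forall>k\<ge>K. y \<notin> A k}"
  have S[measurable]: "S \<in> sets \<nu>"
    unfolding S_def by measurable
  \<comment> \<open>Off the full-measure set \<open>S\<close> both the limit and the approximants
    are set to 0, so that \<open>lim_measurable\<close> has convergence at every point.\<close>
  define \<phi> where "\<phi> y = (if y \<in> S then SOME l. (\<lambda>k. d (\<psi> k y) l) \<longlonglongrightarrow> 0 else 0)" for y
  have lim: "(\<lambda>k. d (\<psi> k y) (\<phi> y)) \<longlonglongrightarrow> 0" if "y \<in> S" for y
  proof -
    have "\<exists>l. (\<lambda>k. d (\<psi> k y) l) \<longlonglongrightarrow> 0"
      using that conv unfolding S_def by blast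
    from someI_ex[OF this] show ?thesis using that by (simp add: \<phi>_def)
  qed
  have \<phi>[measurable]: "\<phi> \<in> borel_measurable \<nu>"
  proof (rule lim_measurable)
    show "(\<lambda>y. if y \<in> S then \<psi> k y else 0) \<in> borel_measurable \<nu>" for k
      by measurable
    show "(\<lambda>k. d (if y \<in> S then \<psi> k y else 0) (\<phi> y)) \<longlonglongrightarrow> 0" for y
      using lim[of y] by (cases "y \<in> S") (auto simp: \<phi>_def[of y])
  qed
  have "(\<lambda>k. mean_dist (\<psi> k) \<phi>) \<longlonglongrightarrow> (\<integral>y. 0 \<partial>\<nu>)"
    unfolding mean_dist_def
  proof (rule integral_dominated_convergence[where w = "\<lambda>_. diam"])
    show "AE y in \<nu>. (\<lambda>k. d (\<psi> k y) (\<phi> y)) \<longlonglongrightarrow> 0"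
      using good AE_space by eventually_elim (rule lim, simp add: S_def)
  qed (auto simp: d_le_diam)
  then have mean: "(\<lambda>k. mean_dist (\<psi> k) \<phi>) \<longlonglongrightarrow> 0" by simp
  have "limitin C.mtopology (\<sigma> \<circ> r) (cls \<phi>) sequentially"
    unfolding C.limitin_metric
  proof (intro conjI allI impI)
    show "cls \<phi> \<in> cocycles \<nu>" by (rule cls[OF \<phi>])
    fix e :: real assume "0 < e"
    then have "\<forall>\<^sub>F k in sequentially. mean_dist (\<psi> k) \<phi> < (e / 2)\<^sup>2"
      by (intro order_tendstoD(2)[OF mean]) simp
    then show "\<forall>\<^sub>F k in sequentially. (\<sigma> \<circ> r) k \<in> cocycles \<nu> \<and> cocycle_dist \<nu> d ((\<sigma> \<circ> r) k) (cls \<phi>) < e"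
    proof eventually_elim
      case (elim k)
      then have "map_dist \<nu> d (\<psi> k) \<phi> \<le> e / 2"
        using \<open>0 < e\<close> by (intro map_dist_le_of_mean_dist) auto
      then show ?case
        using \<open>0 < e\<close> \<sigma>C dist_eq[OF \<sigma>C cls(1)[OF \<phi>] \<psi> cls(2)[OF \<phi>], of k] by simp
    qed
  qed
  then show "\<exists>c. limitin C.mtopology \<sigma> c sequentially"
    using C.MCauchy_convergent_subsequence[OF \<sigma> r] by blast
qed

end

section \<open>Standard Borel products\<close>

definition open_base :: "'b topology \<Rightarrow> 'b set set \<Rightarrow> bool" where
  "open_base X \<A> \<longleftrightarrow> (\<forall>A\<in>\<A>. openin X A) \<and>
     (\<forall>U. openin X U \<longrightarrow> (\<forall>x\<in>U. \<exists>A\<in>\<A>. x \<in> A \<and> A \<subseteq> U))"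

lemma open_baseD:
  assumes "open_base X \<A>"
  shows "A \<in> \<A> \<Longrightarrow> openin X A"
    and "openin X U \<Longrightarrow> x \<in> U \<Longrightarrow> \<exists>A\<in>\<A>. x \<in> A \<and> A \<subseteq> U"
  using assms by (simp_all add: open_base_def)

text \<open>Closing a countable base under finite intersections keeps it countable and makes it a
  pi-system, on whose generated sigma-algebra finite measures can be compared.\<close>

lemma second_countable_Int_stable_base:
  assumes "second_countable X"
  obtains \<A> where "countable \<A>" "Int_stable \<A>" "topspace X \<in> \<A>" "open_base X \<A>"
proof -
  obtain \<B> where "countable \<B> \<and> (\<forall>V\<in>\<B>. openin X V) \<and>
      (\<forall>U x. openin X U \<and> x \<in> U \<longrightarrow> (\<exists>V\<in>\<B>. x \<in> V \<and> V \<subseteq> U))"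
    using assms unfolding second_countable_def by (rule exE)
  then have \<B>: "countable \<B>" "\<And>V. V \<in> \<B> \<Longrightarrow> openin X V"
    "\<And>U x. openin X U \<Longrightarrow> x \<in> U \<Longrightarrow> \<exists>V\<in>\<B>. x \<in> V \<and> V \<subseteq> U"
    by simp_all
  \<comment> \<open>Cutting down to \<open>topspace X\<close> makes the empty family give the whole
    space rather than \<open>UNIV\<close>.\<close>
  define \<A> where "\<A> = (\<lambda>F. topspace X \<inter> \<Inter>F) ` {F. F \<subseteq> \<B> \<and> finite F}"
  show thesis
  proof (rule that)
    show "countable \<A>"
      unfolding \<A>_def
      using countable_Collect_finite_subset[OF \<B>(1)] by (simp add: conj_commute)
    show "Int_stable \<A>"
    proof (rule Int_stableI)
      fix a b assume "a \<in> \<A>" "b \<in> \<A>"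
      then obtain F G where "F \<subseteq> \<B>" "finite F" "G \<subseteq> \<B>" "finite G"
        "a = topspace X \<inter> \<Inter>F" "b = topspace X \<inter> \<Inter>G"
        unfolding \<A>_def by blast
      then show "a \<inter> b \<in> \<A>"
        unfolding \<A>_def by (intro image_eqI[of _ _ "F \<union> G"]) auto
    qed
    show "topspace X \<in> \<A>"
      unfolding \<A>_def by (rule image_eqI[of _ _ "{}"]) auto
    have "openin X A" if "A \<in> \<A>" for A
    proof -
      obtain F where "F \<subseteq> \<B>" "finite F" "A = topspace X \<inter> \<Inter>F"
        using \<open>A \<in> \<A>\<close> unfolding \<A>_def by blast
      moreover have "openin X (\<Inter>(insert (topspace X) F))"
        using calculation \<B>(2) by (intro openin_Inter) auto
      ultimately show ?thesis by simp
    qed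
    moreover have "\<exists>A\<in>\<A>. x \<in> A \<and> A \<subseteq> U" if U: "openin X U" "x \<in> U" for U x
    proof -
      obtain V where V: "V \<in> \<B>" "x \<in> V" "V \<subseteq> U" using \<B>(3)[OF U] by blast
      have "x \<in> topspace X" using openin_subset U by blast
      moreover have "topspace X \<inter> \<Inter>{V} \<in> \<A>"
        unfolding \<A>_def using V by blast
      ultimately show ?thesis using V by (intro bexI[of _ "topspace X \<inter> \<Inter>{V}"]) auto
    qed
    ultimately show "open_base X \<A>"
      by (simp add: open_base_def)
  qed
qed

lemma open_in_sigma_sets_base:
  assumes "countable \<A>" "\<And>A. A \<in> \<A> \<Longrightarrow> A \<subseteq> U \<Longrightarrow> A \<in> sigma_sets \<Omega> \<G>"
    and "\<And>x. x \<in> U \<Longrightarrow> \<exists>A\<in>\<A>. x \<in> A \<and> A \<subseteq> U"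
  shows "U \<in> sigma_sets \<Omega> \<G>"
proof -
  have "\<Union>{A \<in> \<A>. A \<subseteq> U} \<in> sigma_sets \<Omega> \<G>"
    using assms(1,2) by (intro sigma_sets_UNION) auto
  moreover have "\<Union>{A \<in> \<A>. A \<subseteq> U} = U"
    using assms(3) by blast
  ultimately show ?thesis by simp
qed

lemma sigma_sets_base:
  assumes "countable \<A>" and base: "open_base X \<A>"
  shows "sigma_sets (topspace X) {U. openin X U} = sigma_sets (topspace X) \<A>"
proof (rule sigma_sets_eqI)
  show "U \<in> sigma_sets (topspace X) \<A>" if "U \<in> {U. openin X U}" for U
  proof (rule open_in_sigma_sets_base[OF \<open>countable \<A>\<close>])
    show "\<exists>A\<in>\<A>. x \<in> A \<and> A \<subseteq> U" if "x \<in> U" for x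
      using \<open>U \<in> {U. openin X U}\<close> by (intro open_baseD(2)[OF base] that) simp
  qed (rule sigma_sets.Basic)
  show "A \<in> sigma_sets (topspace X) {U. openin X U}" if "A \<in> \<A>" for A
    using open_baseD(1)[OF base that] by (intro sigma_sets.Basic) simp
qed

lemma second_countable_euclidean_class:
  "second_countable (euclidean :: 'g::second_countable_topology topology)"
proof -
  obtain B :: "'g set set" where B: "countable B" "topological_basis B"
    using ex_countable_basis by blast
  show ?thesis
    unfolding second_countable_def
  proof (intro exI[of _ B] conjI allI impI ballI)
    show "openin euclidean V" if "V \<in> B" for V
      using topological_basis_open[OF B(2) that] by simp
    show "\<exists>V\<in>B. x \<in> V \<and> V \<subseteq> U" if "openin euclidean U \<and> x \<in> U" for U x
      using that topological_basisE[OF B(2), of U x] by (metis open_openin)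
  qed (rule B(1))
qed

text \<open>As the generators contain the whole spaces, strips over a generator are generating
  rectangles and both projections are measurable. A measurable rectangle is then an intersection of
  two preimages under the projections.\<close>

lemma sets_pair_generator:
  assumes A: "sets M = sigma_sets (space M) \<A>" "\<A> \<subseteq> Pow (space M)" "space M \<in> \<A>"
    and B: "sets N = sigma_sets (space N) \<B>" "\<B> \<subseteq> Pow (space N)" "space N \<in> \<B>"
  shows "sets (M \<Otimes>\<^sub>M N) = sigma_sets (space M \<times> space N) {a \<times> b |a b. a \<in> \<A> \<and> b \<in> \<B>}"
proof -
  let ?R = "{a \<times> b |a b. a \<in> \<A> \<and> b \<in> \<B>}"
  let ?S = "sigma (space M \<times> space N) ?R"
  have R: "?R \<subseteq> Pow (space M \<times> space N)" using A B by blast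
  have sp: "space ?S = space M \<times> space N" by (rule space_measure_of[OF R])
  have st: "sets ?S = sigma_sets (space M \<times> space N) ?R" by (rule sets_measure_of[OF R])
  have fst: "fst \<in> measurable ?S M"
  proof (rule measurable_sigma_sets[OF A(1,2)])
    fix a assume "a \<in> \<A>"
    then have "fst -` a \<inter> space ?S = a \<times> space N" using A(2) unfolding sp by auto
    then show "fst -` a \<inter> space ?S \<in> sets ?S"
      unfolding st using \<open>a \<in> \<A>\<close> B(3) by (auto intro: sigma_sets.Basic)
  qed (auto simp: sp[simplified])
  have snd: "snd \<in> measurable ?S N"
  proof (rule measurable_sigma_sets[OF B(1,2)])
    fix b assume "b \<in> \<B>"
    then have "snd -` b \<inter> space ?S = space M \<times> b" using B(2) unfolding sp by auto
    then show "snd -` b \<inter> space ?S \<in> sets ?S"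
      unfolding st using \<open>b \<in> \<B>\<close> A(3) by (auto intro: sigma_sets.Basic)
  qed (auto simp: sp[simplified])
  have gen: "a \<times> b \<in> sigma_sets (space M \<times> space N) ?R" if "a \<in> sets M" "b \<in> sets N" for a b
  proof -
    have "a \<times> b = (fst -` a \<inter> space ?S) \<inter> (snd -` b \<inter> space ?S)"
      using that[THEN sets.sets_into_space] unfolding sp by auto
    then show ?thesis
      using measurable_sets[OF fst that(1)] measurable_sets[OF snd that(2)]
      unfolding st[symmetric] by auto
  qed
  have "a \<in> sets M" if "a \<in> \<A>" for a using A that by auto
  moreover have "b \<in> sets N" if "b \<in> \<B>" for b using B that by auto
  ultimately have "?R \<subseteq> {a \<times> b |a b. a \<in> sets M \<and> b \<in> sets N}" by blast
  moreover have "{a \<times> b |a b. a \<in> sets M \<and> b \<in> sets N} \<subseteq> sigma_sets (space M \<times> space N) ?R"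
    using gen by auto
  ultimately show ?thesis
    unfolding sets_pair_measure
    by (intro sigma_sets_eqI) (erule subsetD[rotated], assumption, rule sigma_sets.Basic,
        erule subsetD[rotated], assumption)
qed

text \<open>The product topology is again completely metrizable, and rectangles of base sets form a
  countable base of it. These rectangles generate both its Borel sets and the product
  sigma-algebra.\<close>

lemma standard_borel_pair:
  assumes "standard_borel M" "standard_borel N"
  shows "standard_borel (M \<Otimes>\<^sub>M N)"
proof -
  obtain X where X: "completely_metrizable_space X" "second_countable X" "topspace X = space M"
    "sets M = sigma_sets (topspace X) {U. openin X U}"
    using assms(1) unfolding standard_borel_def by blast
  obtain Z where Z: "completely_metrizable_space Z" "second_countable Z" "topspace Z = space N"
    "sets N = sigma_sets (topspace Z) {U. openin Z U}"
    using assms(2) unfolding standard_borel_def by blast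
  obtain \<A> where \<A>: "countable \<A>" "Int_stable \<A>" "topspace X \<in> \<A>" "open_base X \<A>"
    using second_countable_Int_stable_base[OF X(2)] .
  obtain \<B> where \<B>: "countable \<B>" "Int_stable \<B>" "topspace Z \<in> \<B>" "open_base Z \<B>"
    using second_countable_Int_stable_base[OF Z(2)] .
  define \<R> where "\<R> = {a \<times> b |a b. a \<in> \<A> \<and> b \<in> \<B>}"
  have "\<R> = (\<lambda>(a, b). a \<times> b) ` (\<A> \<times> \<B>)"
    unfolding \<R>_def by auto
  then have cR: "countable \<R>" using \<A> \<B> by simp
  have oR: "openin (prod_topology X Z) R" if "R \<in> \<R>" for R
    using that open_baseD(1)[OF \<A>(4)] open_baseD(1)[OF \<B>(4)] unfolding \<R>_def
    by (auto simp: openin_prod_Times_iff)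
  have base: "\<exists>R\<in>\<R>. p \<in> R \<and> R \<subseteq> U" if "openin (prod_topology X Z) U" "p \<in> U" for U p
  proof -
    obtain x z where p: "p = (x, z)" by (cases p)
    have "(x, z) \<in> U" using that(2) p by simp
    then have "\<exists>V W. openin X V \<and> openin Z W \<and> x \<in> V \<and> z \<in> W \<and> V \<times> W \<subseteq> U"
      using that(1) by (simp only: openin_prod_topology_alt)
    then obtain V W where VW: "openin X V" "openin Z W" "x \<in> V" "z \<in> W" "V \<times> W \<subseteq> U"
      by (elim exE conjE)
    obtain a where a: "a \<in> \<A>" "x \<in> a" "a \<subseteq> V"
      using open_baseD(2)[OF \<A>(4) VW(1,3)] by blast
    obtain b where b: "b \<in> \<B>" "z \<in> b" "b \<subseteq> W"
      using open_baseD(2)[OF \<B>(4) VW(2,4)] by blast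
    have "a \<times> b \<in> \<R>"
      unfolding \<R>_def using a(1) b(1) by blast
    moreover have "p \<in> a \<times> b"
      using a(2) b(2) by (simp add: p)
    moreover have "a \<times> b \<subseteq> U"
      using Sigma_mono[OF a(3) b(3)] VW(5) by (rule subset_trans)
    ultimately show ?thesis by (intro bexI[of _ "a \<times> b"] conjI)
  qed
  then have obR: "open_base (prod_topology X Z) \<R>"
    using oR by (simp add: open_base_def)
  have "sets (M \<Otimes>\<^sub>M N) = sigma_sets (space M \<times> space N) \<R>"
    unfolding \<R>_def
  proof (rule sets_pair_generator)
    show "sets M = sigma_sets (space M) \<A>"
      using X(3,4) sigma_sets_base[OF \<A>(1,4)] by simp
    show "sets N = sigma_sets (space N) \<B>"
      using Z(3,4) sigma_sets_base[OF \<B>(1,4)] by simp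
    show "\<A> \<subseteq> Pow (space M)"
      using openin_subset[OF open_baseD(1)[OF \<A>(4)]] X(3) by auto
    show "\<B> \<subseteq> Pow (space N)"
      using openin_subset[OF open_baseD(1)[OF \<B>(4)]] Z(3) by auto
  qed (use \<A>(3) \<B>(3) X(3) Z(3) in simp_all)
  also have "\<dots> = sigma_sets (topspace (prod_topology X Z)) {U. openin (prod_topology X Z) U}"
    using sigma_sets_base[OF cR obR] X(3) Z(3) by simp
  finally have "sets (M \<Otimes>\<^sub>M N) = sigma_sets (topspace (prod_topology X Z)) {U. openin (prod_topology X Z) U}" .
  moreover have "second_countable (prod_topology X Z)"
    unfolding second_countable_def
    using cR open_baseD[OF obR] by (intro exI[of _ \<R>]) simp
  moreover have "completely_metrizable_space (prod_topology X Z)"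
    using X(1) Z(1) by (simp add: completely_metrizable_space_prod_topology)
  ultimately show ?thesis
    unfolding standard_borel_def using X(3) Z(3)
    by (intro exI[of _ "prod_topology X Z"]) (auto simp: space_pair_measure)
qed

text \<open>A compact metric is complete, so \<open>d\<close> itself witnesses complete
  metrizability.\<close>

lemma (in compact_group_metric) standard_borel_group:
  assumes "sets L = sets borel"
  shows "standard_borel (L :: 'g measure)"
  unfolding standard_borel_def
proof (intro exI[of _ euclidean] conjI)
  show "completely_metrizable_space (euclidean :: 'g topology)"
    using D.completely_metrizable_space_mtopology[OF D_complete] by (simp add: mtop)
  show "sets L = sigma_sets (topspace euclidean) {U. openin euclidean U}"
    by (simp add: assms borel_def)
  show "topspace euclidean = space L"
    using sets_eq_imp_space_eq[OF assms] by simp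
qed (rule second_countable_euclidean_class)

section \<open>Genericity\<close>

locale skew_metric = skew_base \<nu> T L + cocycle_space \<nu> d
  for \<nu> :: "'a measure" and T
    and L :: "'g::{topological_group_add, second_countable_topology} measure"
    and d :: "'g \<Rightarrow> 'g \<Rightarrow> real"
begin

lemma system_skew:
  assumes sys: "system \<nu> T" and \<phi>[measurable]: "\<phi> \<in> borel_measurable \<nu>"
  shows "system P (skew_product T \<phi>)"
proof -
  define R where "R = the_inv_into (space \<nu>) T"
  have R[measurable]: "R \<in> measurable \<nu> \<nu>" and bij: "bij_betw T (space \<nu>) (space \<nu>)"
    and std: "standard_borel \<nu>"
    using sys by (auto simp: system_def invertible_mpt_def standard_prob_space_def R_def)
  have TR: "T (R y) = y" "R y \<in> space \<nu>" if "y \<in> space \<nu>" for y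
    using bij that measurable_space[OF R that]
    by (auto simp: R_def bij_betw_def f_the_inv_into_f)
  have RT: "R (T y) = y" if "y \<in> space \<nu>" for y
    using bij that by (auto simp: R_def bij_betw_def the_inv_into_f_f)
  \<comment> \<open>The inverse map: step back in the base, then undo the left addition of the value
    of \<open>\<phi>\<close> at the earlier point.\<close>
  define S where "S = (\<lambda>(y, g). (R y, - \<phi> (R y) + g))"
  have S[measurable]: "S \<in> measurable P P"
    unfolding S_def by measurable
  have Tsp: "T y \<in> space \<nu>" if "y \<in> space \<nu>" for y
    using measurable_space[OF Y.T_measurable that] .
  have sp: "space P = space \<nu> \<times> UNIV" by (simp add: space_pair_measure)
  have b: "bij_betw (skew_product T \<phi>) (space P) (space P)"
    by (rule bij_betw_byWitness[where f' = S])
      (auto simp: sp skew_product_def S_def TR RT Tsp add.assoc[symmetric])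
  have "the_inv_into (space P) (skew_product T \<phi>) p = S p" if "p \<in> space P" for p
  proof (rule the_inv_into_f_eq)
    show "inj_on (skew_product T \<phi>) (space P)" using b by (rule bij_betw_imp_inj_on)
    show "skew_product T \<phi> (S p) = p" "S p \<in> space P"
      using that by (auto simp: sp skew_product_def S_def TR add.assoc[symmetric])
  qed
  then have "the_inv_into (space P) (skew_product T \<phi>) \<in> measurable P P"
    using S by (simp cong: measurable_cong)
  then have "invertible_mpt P (skew_product T \<phi>)"
    unfolding invertible_mpt_def using b distr_skew[OF \<phi>] by auto
  moreover have "standard_prob_space P"
    unfolding standard_prob_space_def
    using standard_borel_pair[OF std standard_borel_group[OF G.sets_L]] P.P.prob_space_axioms by simp
  ultimately show ?thesis unfolding system_def by simp
qed

text \<open>Right invariance makes the distance between the two orbits of \<open>(y, g)\<close>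
  independent of \<open>g\<close>. At every time below \<open>n\<close> it is at most the Birkhoff
  sum of \<open>d (\<phi> y) (\<psi> y)\<close>, whose integral is
  \<open>n * mean_dist \<phi> \<psi>\<close> because \<open>T\<close> preserves the measure.\<close>

lemma avg_err_lipschitz:
  assumes [measurable]: "\<phi> \<in> borel_measurable \<nu>" "\<psi> \<in> borel_measurable \<nu>"
    and f_meas[measurable]: "f \<in> borel_measurable P" and f: "\<And>p. 0 \<le> f p" "\<And>p. f p \<le> 1"
    and K: "0 \<le> K" "\<And>y g h. \<bar>f (y, g) - f (y, h)\<bar> \<le> K * d g h"
  shows "avg_err \<phi> n f \<le> avg_err \<psi> n f + K * n * mean_dist \<phi> \<psi>"
proof -
  define c where "c = (\<integral>p. f p \<partial>P)"
  have c: "0 \<le> c" "c \<le> 1"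
    unfolding c_def using integral_bounds[OF f_meas f] by auto
  define \<Delta> where "\<Delta> y = d (\<phi> y) (\<psi> y)" for y
  have \<Delta>[measurable]: "\<Delta> \<in> borel_measurable \<nu>"
    unfolding \<Delta>_def by measurable
  have \<Delta>0: "0 \<le> \<Delta> y" for y by (simp add: \<Delta>_def)
  define a where "a \<phi> p = (\<Sum>k<n. f ((skew_product T \<phi> ^^ k) p)) / n" for \<phi> p
  have pt: "\<bar>a \<phi> (y, g) - c\<bar> \<le> \<bar>a \<psi> (y, g) - c\<bar> + K * Y.birkhoff_sum \<Delta> n y" for y g
  proof -
    have bs: "0 \<le> K * Y.birkhoff_sum \<Delta> n y"
      unfolding Y.birkhoff_sum_def using K \<Delta>0 by (intro mult_nonneg_nonneg sum_nonneg)
    have "\<bar>(\<Sum>k<n. f ((skew_product T \<phi> ^^ k) (y, g))) - (\<Sum>k<n. f ((skew_product T \<psi> ^^ k) (y, g)))\<bar>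
        \<le> (\<Sum>k<n. \<bar>f ((skew_product T \<phi> ^^ k) (y, g)) - f ((skew_product T \<psi> ^^ k) (y, g))\<bar>)"
      unfolding sum_subtractf[symmetric] by (rule sum_abs)
    also have "\<dots> \<le> (\<Sum>k<n. K * Y.birkhoff_sum \<Delta> n y)"
    proof (rule sum_mono)
      fix k assume k: "k \<in> {..<n}"
      have "\<bar>f ((skew_product T \<phi> ^^ k) (y, g)) - f ((skew_product T \<psi> ^^ k) (y, g))\<bar>
          \<le> K * d (cocycle_sum T \<phi> k y) (cocycle_sum T \<psi> k y)"
        unfolding skew_product_funpow
        using K(2)[of "(T ^^ k) y" "cocycle_sum T \<phi> k y + g" "cocycle_sum T \<psi> k y + g"]
        by (simp add: right_iso)
      also have "\<dots> \<le> K * (\<Sum>j<k. \<Delta> ((T ^^ j) y))"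
        unfolding \<Delta>_def by (intro mult_left_mono cocycle_sum_dist_le K)
      also have "\<dots> \<le> K * Y.birkhoff_sum \<Delta> n y"
        unfolding Y.birkhoff_sum_def using k
        by (intro mult_left_mono sum_mono2 K \<Delta>0) auto
      finally show "\<bar>f ((skew_product T \<phi> ^^ k) (y, g)) - f ((skew_product T \<psi> ^^ k) (y, g))\<bar>
          \<le> K * Y.birkhoff_sum \<Delta> n y" .
    qed
    finally have "\<bar>(\<Sum>k<n. f ((skew_product T \<phi> ^^ k) (y, g))) - (\<Sum>k<n. f ((skew_product T \<psi> ^^ k) (y, g)))\<bar> / n
        \<le> (\<Sum>k<n. K * Y.birkhoff_sum \<Delta> n y) / n"
      by (rule divide_right_mono) simp
    then have "\<bar>a \<phi> (y, g) - a \<psi> (y, g)\<bar> \<le> (n * (K * Y.birkhoff_sum \<Delta> n y)) / n"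
      by (simp only: a_def diff_divide_distrib[symmetric] abs_divide abs_of_nat sum_constant
          card_lessThan)
    \<comment> \<open>Only an inequality: for \<open>n = 0\<close> the quotient is 0 by
      convention.\<close>
    also have "\<dots> \<le> K * Y.birkhoff_sum \<Delta> n y"
      using bs by (cases "n = 0") simp_all
    finally show ?thesis by linarith
  qed
  have am: "(\<lambda>p. \<bar>a \<phi> p - c\<bar>) \<in> borel_measurable P" if [measurable]: "\<phi> \<in> borel_measurable \<nu>" for \<phi>
  proof -
    interpret S: mpt P "skew_product T \<phi>"
      by unfold_locales (auto simp: distr_skew[OF that])
    have "(\<lambda>p. f ((skew_product T \<phi> ^^ k) p)) \<in> borel_measurable P" for k
      by (rule measurable_compose[OF S.funpow_measurable f_meas])
    then show ?thesis unfolding a_def by measurable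
  qed
  have a1: "\<bar>a \<phi> p - c\<bar> \<le> 1" for \<phi> p
    unfolding a_def by (rule average_bounds[where f = f, OF f c])
  have aint: "integrable P (\<lambda>p. \<bar>a \<phi> p - c\<bar>)" if "\<phi> \<in> borel_measurable \<nu>" for \<phi>
    using am[OF that] a1 by (intro P.P.integrable_const_bound[where B = 1]) auto
  have bs_bound: "\<bar>Y.birkhoff_sum \<Delta> n y\<bar> \<le> n * diam" for y
  proof -
    have "\<bar>Y.birkhoff_sum \<Delta> n y\<bar> \<le> (\<Sum>k<n. \<bar>\<Delta> ((T ^^ k) y)\<bar>)"
      unfolding Y.birkhoff_sum_def by (rule sum_abs)
    also have "\<dots> \<le> (\<Sum>k<n. diam)"
      by (intro sum_mono) (simp add: \<Delta>_def d_le_diam)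
    finally show ?thesis by simp
  qed
  have bint: "integrable P (\<lambda>p. Y.birkhoff_sum \<Delta> n (fst p))"
    using bs_bound by (intro P.P.integrable_const_bound[where B = "n * diam"]) auto
  have \<Delta>int: "integrable \<nu> (\<lambda>y. \<Delta> ((T ^^ k) y))" for k
    using measurable_compose[OF Y.funpow_measurable \<Delta>]
    by (intro Y.integrable_const_bound[where B = diam]) (auto simp: \<Delta>_def d_le_diam)
  have "(\<integral>p. Y.birkhoff_sum \<Delta> n (fst p) \<partial>P) = (\<integral>y. Y.birkhoff_sum \<Delta> n y \<partial>\<nu>)"
    using P.integral_fst'[OF bint] by simp
  also have "\<dots> = n * mean_dist \<phi> \<psi>"
    unfolding Y.birkhoff_sum_def using \<Delta>int
    by (simp add: Y.integral_funpow[OF \<Delta>]) (simp add: mean_dist_def \<Delta>_def[abs_def])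
  finally have bs: "(\<integral>p. Y.birkhoff_sum \<Delta> n (fst p) \<partial>P) = n * mean_dist \<phi> \<psi>" .
  have "avg_err \<phi> n f \<le> (\<integral>p. \<bar>a \<psi> p - c\<bar> + K * Y.birkhoff_sum \<Delta> n (fst p) \<partial>P)"
    unfolding avg_err_def a_def[symmetric] c_def[symmetric]
    by (intro integral_mono aint Bochner_Integration.integrable_add integrable_mult_right bint)
      (use pt in auto)
  also have "\<dots> = avg_err \<psi> n f + K * n * mean_dist \<phi> \<psi>"
    unfolding avg_err_def a_def[symmetric] c_def[symmetric]
    using aint bint by (simp add: bs)
  finally show ?thesis .
qed

section \<open>Test functions and the triviality of invariant sets\<close>

definition test_fun :: "'a set \<Rightarrow> 'g set \<Rightarrow> nat \<Rightarrow> 'a \<times> 'g \<Rightarrow> real" where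
  "test_fun A U m = (\<lambda>(y, g). indicator A y * min 1 (m * dist_compl U g))"

lemma test_fun_measurable [measurable]:
  assumes [measurable]: "A \<in> sets \<nu>"
  shows "test_fun A U m \<in> borel_measurable P"
proof -
  have [measurable]: "dist_compl U \<in> borel_measurable L"
    by (simp add: measurable_cong_sets[OF G.sets_L refl])
  show ?thesis unfolding test_fun_def split_beta' by measurable
qed

lemma test_fun_bounds: "0 \<le> test_fun A U m p" "test_fun A U m p \<le> 1"
  using dist_compl_nonneg by (auto simp: test_fun_def indicator_def split: prod.split)

text \<open>This control in the group coordinate, which \<open>avg_err_lipschitz\<close> requires,
  is why indicators of open sets are replaced by truncated multiples of
  \<open>dist_compl\<close>.\<close>

lemma test_fun_lipschitz: "\<bar>test_fun A U m (y, g) - test_fun A U m (y, h)\<bar> \<le> m * d g h"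
proof -
  have "\<bar>m * dist_compl U g - m * dist_compl U h\<bar> \<le> m * d g h"
    using mult_left_mono[OF dist_compl_lipschitz[of U g h], of "real m"]
    by (simp add: right_diff_distrib[symmetric] abs_mult)
  then show ?thesis
    by (auto simp: test_fun_def indicator_def)
qed

lemma test_fun_tendsto:
  assumes "open U"
  shows "(\<lambda>m. test_fun A U m p) \<longlonglongrightarrow> indicator (A \<times> U) p"
proof -
  obtain y g where p: "p = (y, g)" by (cases p)
  show ?thesis
  proof (cases "g \<in> U")
    case True
    then have pos: "0 < dist_compl U g" using dist_compl_pos_iff[OF assms] by simp
    obtain N :: nat where N: "1 / dist_compl U g < N" using reals_Archimedean2 by blast
    have "test_fun A U m p = indicator (A \<times> U) p" if "m \<ge> N" for m
    proof -
      have "1 / dist_compl U g \<le> m" using N that by linarith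
      then have "1 \<le> m * dist_compl U g" using pos by (simp add: field_simps)
      then show ?thesis using True by (simp add: p test_fun_def indicator_def)
    qed
    then show ?thesis
      by (intro tendsto_eventually) (auto simp: eventually_sequentially)
  next
    case False
    then have "dist_compl U g = 0"
      using dist_compl_pos_iff[OF assms, of g] dist_compl_nonneg[of U g] by linarith
    then show ?thesis using False by (simp add: p test_fun_def)
  qed
qed

text \<open>If the averages of \<open>f\<close> come arbitrarily close to a constant in the mean, then \<open>f\<close> is
  uncorrelated with every invariant set.\<close>

lemma invariant_uncorrelated:
  assumes \<phi>[measurable]: "\<phi> \<in> borel_measurable \<nu>"
    and f_meas[measurable]: "f \<in> borel_measurable P" and f: "\<And>p. 0 \<le> f p" "\<And>p. f p \<le> 1"
    and avg: "\<And>e. 0 < e \<Longrightarrow> \<exists>n>0. avg_err \<phi> n f < e"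
    and C[measurable]: "C \<in> sets P" and inv: "skew_product T \<phi> -` C \<inter> space P = C"
  shows "(\<integral>p. indicator C p * f p \<partial>P) = measure P C * (\<integral>p. f p \<partial>P)"
proof -
  interpret S: mpt P "skew_product T \<phi>"
    by unfold_locales (auto simp: distr_skew[OF \<phi>])
  let ?S = "skew_product T \<phi>"
  define c where "c = (\<integral>p. f p \<partial>P)"
  have c: "0 \<le> c" "c \<le> 1"
    unfolding c_def using integral_bounds[OF f_meas f] by auto
  have "?S p \<in> C \<longleftrightarrow> p \<in> C" if "p \<in> space P" for p
    using inv that by blast
  then have invk: "(?S ^^ k) p \<in> C \<longleftrightarrow> p \<in> C" if "p \<in> space P" for k p
    using that measurable_space[OF S.funpow_measurable] by (induction k) auto
  have fk[measurable]: "(\<lambda>p. f ((?S ^^ k) p)) \<in> borel_measurable P" for k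
    by (rule measurable_compose[OF S.funpow_measurable f_meas])
  define J where "J k p = indicator C p * f ((?S ^^ k) p)" for k p
  have k: "(\<integral>p. J k p \<partial>P) = (\<integral>p. indicator C p * f p \<partial>P)" for k
  proof -
    \<comment> \<open>Invariance of \<open>C\<close> lets its indicator be shifted along with
      \<open>f\<close>, and then the measure is preserved.\<close>
    have "(\<integral>p. J k p \<partial>P) = (\<integral>p. indicator C ((?S ^^ k) p) * f ((?S ^^ k) p) \<partial>P)"
      by (intro Bochner_Integration.integral_cong) (auto simp: J_def invk indicator_def)
    also have "\<dots> = (\<integral>p. indicator C p * f p \<partial>P)"
      using S.integral_funpow[of "\<lambda>p. indicator C p * f p" k] by simp
    finally show ?thesis .
  qed
  have ik: "integrable P (J k)" for k
    unfolding J_def using f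
    by (intro P.P.integrable_const_bound[where B = 1]) (auto simp: indicator_def)
  have iC: "integrable P (indicat_real C)"
    by (intro integrable_real_indicator) (auto simp: P.P.emeasure_eq_measure)
  let ?x = "(\<integral>p. indicator C p * f p \<partial>P) - measure P C * c"
  have "\<bar>?x\<bar> \<le> e" if "0 < e" for e
  proof -
    obtain n where n: "0 < n" "avg_err \<phi> n f < e" using avg[OF \<open>0 < e\<close>] by blast
    define a where "a p = (\<Sum>k<n. f ((?S ^^ k) p)) / n - c" for p
    have a_meas[measurable]: "a \<in> borel_measurable P" unfolding a_def by measurable
    have a1: "\<bar>a p\<bar> \<le> 1" for p
      unfolding a_def by (rule average_bounds[where f = f, OF f c])
    have "(\<integral>p. indicator C p * a p \<partial>P) =
        (\<integral>p. (\<Sum>k<n. J k p) / n - c * indicator C p \<partial>P)"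
      by (intro Bochner_Integration.integral_cong)
        (simp_all add: a_def J_def sum_distrib_left[symmetric] algebra_simps)
    \<comment> \<open>All \<open>n\<close> integrals of \<open>J k\<close> are equal, so for
      positive \<open>n\<close> their average is that common value.\<close>
    also have "\<dots> = ?x"
      using ik iC n(1) by (simp add: k)
    finally have "\<bar>?x\<bar> = \<bar>\<integral>p. indicator C p * a p \<partial>P\<bar>" by simp
    also have "\<dots> \<le> (\<integral>p. \<bar>indicator C p * a p\<bar> \<partial>P)"
      by (rule integral_abs_bound)
    also have "\<dots> \<le> (\<integral>p. \<bar>a p\<bar> \<partial>P)"
      using a1 by (intro integral_mono P.P.integrable_const_bound[where B = 1])
        (auto simp: indicator_def)
    also have "\<dots> = avg_err \<phi> n f"
      by (simp add: avg_err_def a_def c_def)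
    finally show ?thesis using n by simp
  qed
  then have "\<bar>?x\<bar> \<le> 0" by (rule field_le_epsilon[where y = 0, simplified])
  then show ?thesis by (simp add: c_def)
qed

text \<open>Letting \<open>m\<close> grow makes \<open>C\<close> independent of each rectangle of
  base sets. These form a generating pi-system, so \<open>C\<close> is independent of every
  measurable set, in particular of itself, and its measure equals its own square.\<close>

lemma invariant_trivial:
  assumes \<phi>[measurable]: "\<phi> \<in> borel_measurable \<nu>"
    and \<A>: "Int_stable \<A>" "space \<nu> \<in> \<A>" "\<A> \<subseteq> Pow (space \<nu>)" "sets \<nu> = sigma_sets (space \<nu>) \<A>"
    and \<U>: "Int_stable \<U>" "UNIV \<in> \<U>" "\<And>U. U \<in> \<U> \<Longrightarrow> open U" "sets (borel :: 'g measure) = sigma_sets UNIV \<U>"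
    and avg: "\<And>A U m e. A \<in> \<A> \<Longrightarrow> U \<in> \<U> \<Longrightarrow> 0 < e \<Longrightarrow> \<exists>n>0. avg_err \<phi> n (test_fun A U m) < e"
    and C[measurable]: "C \<in> sets P" and inv: "skew_product T \<phi> -` C \<inter> space P = C"
  shows "measure P C = 0 \<or> measure P C = 1"
proof -
  have rect: "measure P (C \<inter> (A \<times> U)) = measure P C * measure P (A \<times> U)" if "A \<in> \<A>" "U \<in> \<U>" for A U
  proof -
    have A[measurable]: "A \<in> sets \<nu>" using \<A>(4) that by auto
    have U: "open U" using \<U>(3) that by blast
    have [measurable]: "A \<times> U \<in> sets P"
      using U by (intro pair_measureI A) (simp add: G.sets_L)
    have uncor: "(\<integral>p. indicator C p * test_fun A U m p \<partial>P) = measure P C * (\<integral>p. test_fun A U m p \<partial>P)" for m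
      using avg[OF that] by (intro invariant_uncorrelated[OF \<phi> _ _ _ _ C inv])
        (auto simp: test_fun_bounds)
    have 1: "(\<lambda>m. \<integral>p. indicator C p * test_fun A U m p \<partial>P) \<longlonglongrightarrow> (\<integral>p. indicator C p * indicator (A \<times> U) p \<partial>P)"
    proof (rule integral_dominated_convergence[where w = "\<lambda>_. 1"])
      show "AE p in P. (\<lambda>m. indicator C p * test_fun A U m p) \<longlonglongrightarrow> indicator C p * indicator (A \<times> U) p"
        by (intro AE_I2 tendsto_mult tendsto_const test_fun_tendsto U)
    qed (auto simp: indicator_def test_fun_bounds)
    have "(\<lambda>m. \<integral>p. test_fun A U m p \<partial>P) \<longlonglongrightarrow> (\<integral>p. indicator (A \<times> U) p \<partial>P)"
      by (rule integral_dominated_convergence[where w = "\<lambda>_. 1"])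
        (auto intro!: test_fun_tendsto U simp: test_fun_bounds)
    from tendsto_mult[OF tendsto_const this, of "measure P C"] 1
    have "(\<integral>p. indicator C p * indicator (A \<times> U) p \<partial>P) = measure P C * (\<integral>p. indicator (A \<times> U) p \<partial>P)"
      unfolding uncor by (rule LIMSEQ_unique[rotated])
    then show ?thesis
      by (simp add: indicator_inter_arith[symmetric])
  qed
  let ?R = "{a \<times> b |a b. a \<in> \<A> \<and> b \<in> \<U>}"
  have gen: "sets P = sigma_sets (space P) ?R"
    unfolding space_pair_measure
    using \<A> \<U> by (intro sets_pair_generator) (auto simp: G.sets_L)
  have "density P (indicator C) = density P (\<lambda>_. ennreal (measure P C))"
  proof (rule measure_eqI_generator_eq[where E = ?R and \<Omega> = "space P" and A = "\<lambda>_. space P"])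
    show "Int_stable ?R"
    proof (rule Int_stableI)
      fix a b assume "a \<in> ?R" "b \<in> ?R"
      then obtain A U B V where "a = A \<times> U" "b = B \<times> V" "A \<in> \<A>" "B \<in> \<A>" "U \<in> \<U>" "V \<in> \<U>" by blast
      then have "a \<inter> b = (A \<inter> B) \<times> (U \<inter> V)" "A \<inter> B \<in> \<A>" "U \<inter> V \<in> \<U>"
        using \<A>(1) \<U>(1) by (auto simp: Int_stable_def)
      then show "a \<inter> b \<in> ?R" by blast
    qed
    show "?R \<subseteq> Pow (space P)"
      using \<A>(3) by (auto simp: space_pair_measure)
    fix X assume "X \<in> ?R"
    then obtain A U where X: "X = A \<times> U" "A \<in> \<A>" "U \<in> \<U>" by blast
    have [measurable]: "X \<in> sets P"
      unfolding gen using \<open>X \<in> ?R\<close> by (rule sigma_sets.Basic)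
    have "emeasure (density P (indicator C)) X = emeasure P (C \<inter> X)"
      by (simp add: emeasure_density indicator_inter_arith[symmetric])
    also have "\<dots> = ennreal (measure P C * measure P X)"
      using rect[OF X(2,3)] by (simp add: P.P.emeasure_eq_measure X(1))
    also have "\<dots> = emeasure (density P (\<lambda>_. ennreal (measure P C))) X"
      by (simp add: emeasure_density nn_integral_cmult P.P.emeasure_eq_measure ennreal_mult)
    finally show "emeasure (density P (indicator C)) X = emeasure (density P (\<lambda>_. ennreal (measure P C))) X" .
  next
    show "range (\<lambda>_::nat. space P) \<subseteq> ?R"
      using \<A>(2) \<U>(2) by (auto simp: space_pair_measure)
    show "emeasure (density P (indicator C)) (space P) \<noteq> \<infinity>"
      by (simp add: emeasure_density indicator_inter_arith[symmetric] P.P.emeasure_eq_measure)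
  qed (use gen in auto)
  then have "emeasure (density P (indicator C)) C = emeasure (density P (\<lambda>_. ennreal (measure P C))) C"
    by simp
  then have "ennreal (measure P C) = ennreal (measure P C * measure P C)"
    by (simp add: emeasure_density indicator_inter_arith[symmetric] nn_integral_cmult
        P.P.emeasure_eq_measure ennreal_mult)
  then have "measure P C = measure P C * measure P C"
    by simp
  then show ?thesis by simp
qed

section \<open>Open dense sets of cocycles and Baire's theorem\<close>

definition averaging :: "('a \<times> 'g \<Rightarrow> real) \<Rightarrow> real \<Rightarrow> ('a \<Rightarrow> 'g) set set" where
  "averaging f e = {c \<in> cocycles \<nu>. \<exists>\<phi>\<in>c. \<exists>n>0. avg_err \<phi> n f < e}"

text \<open>Two representatives of a class have \<open>mean_dist\<close> zero, so by the Lipschitz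
  estimate they share the same \<open>n\<close>. Hence \<open>averaging\<close> may ask for just one
  representative.\<close>

lemma averaging_all_representatives:
  assumes A: "A \<in> sets \<nu>" and c: "c \<in> averaging (test_fun A U m) e" and \<psi>: "\<psi> \<in> c"
  shows "\<exists>n>0. avg_err \<psi> n (test_fun A U m) < e"
proof -
  obtain \<phi> n where c': "c \<in> cocycles \<nu>" and \<phi>: "\<phi> \<in> c" and n: "0 < n" "avg_err \<phi> n (test_fun A U m) < e"
    using c by (auto simp: averaging_def)
  have [measurable]: "\<phi> \<in> borel_measurable \<nu>" "\<psi> \<in> borel_measurable \<nu>"
    using cocycleD(1)[OF c'] \<phi> \<psi> by auto
  have "mean_dist \<psi> \<phi> = (\<integral>y. 0 \<partial>\<nu>)"
    unfolding mean_dist_def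
    using cocycleD(2)[OF c' \<psi> \<phi>] by (intro integral_cong_AE) (auto elim!: eventually_mono)
  then have "avg_err \<psi> n (test_fun A U m) \<le> avg_err \<phi> n (test_fun A U m)"
    using avg_err_lipschitz[of \<psi> \<phi> "test_fun A U m" "real m" n] A
    by (simp add: test_fun_bounds test_fun_lipschitz)
  then show ?thesis using n by (intro exI[of _ n]) auto
qed

text \<open>For the \<open>n\<close> that witnesses membership, the error is Lipschitz in the
  cocycle, so the strict inequality survives a small perturbation.\<close>

lemma openin_averaging:
  assumes A: "A \<in> sets \<nu>"
  shows "openin C.mtopology (averaging (test_fun A U m) e)"
  unfolding C.openin_mtopology
proof (intro conjI allI impI)
  show "averaging (test_fun A U m) e \<subseteq> cocycles \<nu>"
    by (auto simp: averaging_def)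
  fix c assume "c \<in> averaging (test_fun A U m) e"
  then obtain \<phi> n where c: "c \<in> cocycles \<nu>" and \<phi>: "\<phi> \<in> c" and n: "0 < n" "avg_err \<phi> n (test_fun A U m) < e"
    by (auto simp: averaging_def)
  \<comment> \<open>\<open>s\<close> is the available slack, and \<open>k\<close> exceeds by 1 the
    factor by which a distance in the metric can enlarge the error. The 1 keeps \<open>k\<close>
    positive for \<open>m = 0\<close> and makes the final estimate strict.\<close>
  define s where "s = e - avg_err \<phi> n (test_fun A U m)"
  define k where "k = real m * n * (1 + diam) + 1"
  have "0 < k" using diam_pos by (auto simp: k_def intro!: add_nonneg_pos)
  have "0 < s" using n by (simp add: s_def)
  show "\<exists>r>0. C.mball c r \<subseteq> averaging (test_fun A U m) e"
  proof (intro exI[of _ "s / k"] conjI subsetI)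
    show "0 < s / k" using \<open>0 < s\<close> \<open>0 < k\<close> by simp
    fix c' assume "c' \<in> C.mball c (s / k)"
    then have c': "c' \<in> cocycles \<nu>" and near: "cocycle_dist \<nu> d c c' < s / k"
      by auto
    obtain \<psi> where \<psi>: "\<psi> \<in> c'" using cocycleD(3)[OF c'] by blast
    have [measurable]: "\<phi> \<in> borel_measurable \<nu>" "\<psi> \<in> borel_measurable \<nu>"
      using cocycleD(1) c c' \<phi> \<psi> by auto
    have "map_dist \<nu> d \<psi> \<phi> < s / k"
      using near dist_eq[OF c' c \<psi> \<phi>] C.commute[of c c'] by simp
    then have "mean_dist \<psi> \<phi> \<le> (1 + diam) * (s / k)"
      by (intro mean_dist_le) auto
    then have "real m * n * mean_dist \<psi> \<phi> \<le> real m * n * ((1 + diam) * (s / k))"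
      by (intro mult_left_mono) auto
    also have "\<dots> = (k - 1) * (s / k)"
      by (simp add: k_def)
    also have "\<dots> < k * (s / k)"
      using \<open>0 < s\<close> \<open>0 < k\<close> by (intro mult_strict_right_mono) auto
    also have "\<dots> = s" using \<open>0 < k\<close> by simp
    finally have "avg_err \<psi> n (test_fun A U m) < e"
      using avg_err_lipschitz[of \<psi> \<phi> "test_fun A U m" "real m" n] A
      by (simp add: test_fun_bounds test_fun_lipschitz s_def)
    then show "c' \<in> averaging (test_fun A U m) e"
      using c' \<psi> n(1) by (auto simp: averaging_def)
  qed
qed

text \<open>Cocycles that differ only on a set of measure below \<open>s\<close> are within
  \<open>s\<close> of each other, so \<open>exists_close_averaging_cocycle\<close> approximates any
  class.\<close>

lemma dense_averaging:
  assumes na: "nonatomic \<nu>" and f: "f \<in> borel_measurable P" "\<And>p. 0 \<le> f p" "\<And>p. f p \<le> 1"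
    and "0 < e"
  shows "C.mtopology closure_of (averaging f e) = cocycles \<nu>"
proof -
  have "c \<in> C.mtopology closure_of (averaging f e)" if c: "c \<in> cocycles \<nu>" for c
    unfolding C.metric_closure_of
  proof (simp add: c, intro allI impI)
    fix r :: real assume "0 < r"
    \<comment> \<open>The same \<open>s\<close> bounds the averaging error and the distance; half of
      \<open>r\<close> is taken because \<open>map_dist_le\<close> gives only a weak
      inequality.\<close>
    define s where "s = min e (r / 2)"
    have s: "0 < s" "s \<le> e" "s < r" using \<open>0 < r\<close> \<open>0 < e\<close> by (auto simp: s_def)
    obtain \<phi> where \<phi>: "\<phi> \<in> c" using cocycleD(3)[OF c] by blast
    have \<phi>m[measurable]: "\<phi> \<in> borel_measurable \<nu>" using cocycleD(1)[OF c \<phi>] .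
    obtain \<psi> n where \<psi>[measurable]: "\<psi> \<in> borel_measurable \<nu>"
      and diff: "measure \<nu> {y \<in> space \<nu>. \<psi> y \<noteq> \<phi> y} < s" and n: "0 < n" "avg_err \<psi> n f < s"
      using exists_close_averaging_cocycle[OF na \<phi>m f s(1)] .
    have "{y \<in> space \<nu>. \<psi> y \<noteq> \<phi> y} = {y \<in> space \<nu>. 0 < d (\<phi> y) (\<psi> y)}"
      using D.mdist_pos_eq by (auto simp: D.commute)
    then have eq: "measure \<nu> {y \<in> space \<nu>. 0 < d (\<phi> y) (\<psi> y)} < s"
      using diff by simp
    have "measure \<nu> {y \<in> space \<nu>. s < d (\<phi> y) (\<psi> y)} \<le> measure \<nu> {y \<in> space \<nu>. 0 < d (\<phi> y) (\<psi> y)}"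
      using s(1) by (intro Y.finite_measure_mono far_measurable \<phi>m \<psi>) auto
    then have "map_dist \<nu> d \<phi> \<psi> \<le> s"
      using eq by (intro map_dist_le) linarith
    then have "cocycle_dist \<nu> d c (cls \<psi>) < r"
      using dist_eq[OF c cls(1)[OF \<psi>] \<phi> cls(2)[OF \<psi>]] s by simp
    moreover have "cls \<psi> \<in> averaging f e"
      using cls[OF \<psi>] n s by (force simp: averaging_def)
    ultimately show "\<exists>c'\<in>averaging f e. c' \<in> cocycles \<nu> \<and> cocycle_dist \<nu> d c c' < r"
      using cls(1)[OF \<psi>] by blast
  qed
  then show ?thesis
    using closure_of_subset_topspace[of C.mtopology] by auto
qed

text \<open>The metric is complete, so a countable intersection of dense open sets
  \<open>averaging\<close> is dense. Every class in it meets the hypothesis of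
  \<open>invariant_trivial\<close> through each of its representatives.\<close>

lemma generic_ergodic:
  assumes sys: "system \<nu> T" and na: "nonatomic \<nu>"
  shows "generic_in (cocycle_topology \<nu> d)
    {c \<in> cocycles \<nu>. \<forall>\<phi>\<in>c. ergodic_system P (skew_product T \<phi>)}"
proof -
  obtain X where X: "second_countable X" "topspace X = space \<nu>"
    "sets \<nu> = sigma_sets (topspace X) {U. openin X U}"
    using sys unfolding system_def standard_prob_space_def standard_borel_def by blast
  obtain \<A> where \<A>: "countable \<A>" "Int_stable \<A>" "topspace X \<in> \<A>" "open_base X \<A>"
    using second_countable_Int_stable_base[OF X(1)] .
  obtain \<U> :: "'g set set" where \<U>: "countable \<U>" "Int_stable \<U>" "topspace euclidean \<in> \<U>"
    "open_base euclidean \<U>"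
    using second_countable_Int_stable_base[OF second_countable_euclidean_class] .
  have genA: "sets \<nu> = sigma_sets (space \<nu>) \<A>"
    using sigma_sets_base[OF \<A>(1,4)] X by simp
  have genU: "sets (borel :: 'g measure) = sigma_sets UNIV \<U>"
    using sigma_sets_base[OF \<U>(1,4)] by (simp add: borel_def)
  have Asets: "A \<in> sets \<nu>" if "A \<in> \<A>" for A
    unfolding genA using that by (rule sigma_sets.Basic)
  \<comment> \<open>Base sets, integer slopes and errors \<open>inverse (real (Suc k))\<close> keep
    the family countable while still reaching every positive error.\<close>
  define \<G> where "\<G> = (\<lambda>(A, U, m, k). averaging (test_fun A U m) (inverse (real (Suc k)))) ` (\<A> \<times> \<U> \<times> UNIV \<times> UNIV)"
  have cG: "countable \<G>"
    unfolding \<G>_def using \<A>(1) \<U>(1) by (intro countable_image countable_SIGMA) auto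
  have G: "openin C.mtopology W \<and> C.mtopology closure_of W = cocycles \<nu>" if "W \<in> \<G>" for W
    using that openin_averaging[OF Asets] dense_averaging[OF na test_fun_measurable[OF Asets]]
    by (auto simp: \<G>_def test_fun_bounds)
  \<comment> \<open>An empty family would have intersection \<open>UNIV\<close> instead of a set of
    cocycles.\<close>
  have ne: "\<G> \<noteq> {}"
    unfolding \<G>_def using \<A>(3) \<U>(3) by auto
  have top: "cocycle_topology \<nu> d = C.mtopology"
    by (simp add: cocycle_topology_def)
  have dense: "C.mtopology closure_of \<Inter>\<G> = cocycles \<nu>"
    using C.metric_Baire_category[OF C_complete cG G] by simp
  have gdelta: "gdelta_in C.mtopology (\<Inter>\<G>)"
    using cG ne G by (intro gdelta_in_Inter) (auto intro: open_imp_gdelta_in)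
  have "ergodic_system P (skew_product T \<phi>)" if c: "c \<in> \<Inter>\<G>" and \<phi>: "\<phi> \<in> c" for c \<phi>
  proof -
    have cW: "c \<in> averaging (test_fun A U m) (inverse (real (Suc k)))" if "A \<in> \<A>" "U \<in> \<U>" for A U m k
      using c that unfolding \<G>_def by blast
    have "c \<in> cocycles \<nu>"
      using cW[OF \<A>(3) \<U>(3)] by (simp add: averaging_def)
    then have \<phi>m: "\<phi> \<in> borel_measurable \<nu>"
      using cocycleD(1) \<phi> by blast
    have avg: "\<exists>n>0. avg_err \<phi> n (test_fun A U m) < e" if A: "A \<in> \<A>" and U: "U \<in> \<U>" and "0 < e" for A U m e
    proof -
      obtain k where "inverse (real (Suc k)) < e"
        using reals_Archimedean[OF \<open>0 < e\<close>] by blast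
      then show ?thesis
        using averaging_all_representatives[OF Asets[OF A] cW[OF A U] \<phi>] by (meson less_trans)
    qed
    show ?thesis
      unfolding ergodic_system_def
    proof (intro conjI ballI impI)
      show "system P (skew_product T \<phi>)" by (rule system_skew[OF sys \<phi>m])
      fix B assume B: "B \<in> sets P" "skew_product T \<phi> -` B \<inter> space P = B"
      show "measure P B = 0 \<or> measure P B = 1"
      proof (rule invariant_trivial[OF \<phi>m \<A>(2) _ _ genA \<U>(2) _ _ genU avg B])
        show "space \<nu> \<in> \<A>" "UNIV \<in> \<U>" using \<A>(3) \<U>(3) X(2) by simp_all
        show "\<A> \<subseteq> Pow (space \<nu>)"
          using sets.sets_into_space[OF Asets] by auto
        show "open U" if "U \<in> \<U>" for U
          using open_baseD(1)[OF \<U>(4) that] by simp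
      qed
    qed
  qed
  moreover have "\<Inter>\<G> \<subseteq> cocycles \<nu>"
    using ne G openin_subset[of C.mtopology] by fastforce
  ultimately show ?thesis
    unfolding generic_in_def top using gdelta dense by (intro exI[of _ "\<Inter>\<G>"]) auto
qed

end

theorem theorem3p1:
  fixes \<nu> :: "'a measure" and T :: "'a \<Rightarrow> 'a"
    and \<mu>\<^sub>G :: "'g::{topological_group_add, second_countable_topology} measure"
    and d\<^sub>G :: "'g \<Rightarrow> 'g \<Rightarrow> real"
  assumes "ergodic_system \<nu> T" and "nonatomic \<nu>"
    and "compact (UNIV :: 'g set)"
    and "normalized_haar \<mu>\<^sub>G"
    and "biinvariant_compatible_metric d\<^sub>G"
  shows "generic_in (cocycle_topology \<nu> d\<^sub>G)
           {c \<in> cocycles \<nu>. \<forall>\<phi>\<in>c. ergodic_system (\<nu> \<Otimes>\<^sub>M \<mu>\<^sub>G) (skew_product T \<phi>)}"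
proof -
  have sys: "system \<nu> T"
    using assms(1) by (simp add: ergodic_system_def)
  interpret Y: ergodic_mpt \<nu> T
    using assms(1)
    by (auto simp: ergodic_mpt_def ergodic_mpt_axioms_def mpt_def mpt_axioms_def
        ergodic_system_def system_def standard_prob_space_def invertible_mpt_def)
  interpret G: haar \<mu>\<^sub>G
    using assms(4) by (auto simp: haar_def haar_axioms_def normalized_haar_def)
  interpret compact_group_metric d\<^sub>G
    using assms(3,5) by (auto simp: compact_group_metric_def biinvariant_compatible_metric_def)
  interpret skew_metric \<nu> T \<mu>\<^sub>G d\<^sub>G ..
  show ?thesis
    by (rule generic_ergodic[OF sys assms(2)])
qed

end
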